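(* For every $k\in\mathbf{N}$ and every parcelwise-$\mathcal{C}^k$ self-transformation $\sigma$ of $\mathbf{R}/\mathbf{Z}$, there exist integers $0\le m_0\le\dots\le m_k$ and bounded non-negative even functions $b_i:\mathbf{Z}\to\mathbf{N}$ ($0\le i\le k$) such that for all $i\in\{0,\dots,k\}$ (and all $n\in\mathbf{Z}$) we have $k_{\le i}(\sigma^n)=m_i|n|+b_i(n)$. In particular, for each $i$, each of $n\mapsto k_{\le i}(\sigma^n)$ and $n\mapsto k_i(\sigma^n)$ either grows linearly or is bounded.
   Context: $\mathbf{N}=\{0,1,2,\dots\}$. A parcelwise-$\mathcal{C}^k$ self-transformation $\sigma$ of $\mathbf{R}/\mathbf{Z}$ is a $\mathcal{C}^k$-diffeomorphism (homeomorphism if $k=0$) between two cofinite subsets of $\mathbf{R}/\mathbf{Z}$, two of these being identified if they coincide on a cofinite subset; these form a group under composition. For such $\sigma$, let $K_0(\sigma)$ be the set of outer discontinuity points of $\sigma$, i.e. the set of $x$ such that the one-sided limits satisfy $\sigma(x^+)\neq\sigma(x^-)$. For $x\notin K_0(\sigma)$, choose the value $\sigma(x)$ as the one making $\sigma$ continuous at $x$. For $i\in\{1,\dots,k\}$, let $K_i(\sigma)$ be the set of those $x\notin K_0(\sigma)\cup\dots\cup K_{i-1}(\sigma)$ at the neighborhood of which $\sigma$ is not of class $\mathcal{C}^i$. For $i\in\{0,\dots,k\}$, let $k_i(\sigma)$ be the cardinal of $K_i(\sigma)$ and $k_{\le i}(\sigma)=\sum_{j=0}^ik_j(\sigma)$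.
   Formalization: For i≥1, "σ is not of class C^i" near x, in the definition of K_i, is read as "σ is not a local C^i-diffeomorphism at x"; read as mere C^i-regularity of the function, the claim fails (σ(s)=4s³ mod 1 on [-1/2,1/2], k=1, contradicts b_1 even). *)

theory Defs
  imports "HOL-Analysis.Analysis" "HOL-Algebra.Group"
begin

section \<open>The circle $\mathbf{R}/\mathbf{Z}$\<close>

quotient_type circle = real / "\<lambda>s t. s - t \<in> \<int>"
  morphisms rep_circle proj
proof (rule equivpI)
  show "reflp (\<lambda>s t::real. s - t \<in> \<int>)"
    by (simp add: reflp_def)
  show "symp (\<lambda>s t::real. s - t \<in> \<int>)"
    by (rule sympI) (metis Ints_minus minus_diff_eq)
  show "transp (\<lambda>s t::real. s - t \<in> \<int>)"
  proof (rule transpI)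
    fix s t u :: real
    assume "s - t \<in> \<int>" "t - u \<in> \<int>"
    then have "(s - t) + (t - u) \<in> \<int>" by (rule Ints_add)
    then show "s - u \<in> \<int>" by simp
  qed
qed

lemma proj_eq_iff: "proj s = proj t \<longleftrightarrow> s - t \<in> \<int>"
  by (rule circle.abs_eq_iff)

lemma proj_surj: "\<exists>t. x = proj t"
  by (induction x) auto

instantiation circle :: ab_group_add
begin

lift_definition zero_circle :: circle is "0::real" .

lift_definition plus_circle :: "circle \<Rightarrow> circle \<Rightarrow> circle" is "(+)"
proof -
  fix s t u v :: real
  assume "s - t \<in> \<int>" "u - v \<in> \<int>"
  then have "(s - t) + (u - v) \<in> \<int>" by (rule Ints_add)
  then show "s + u - (t + v) \<in> \<int>" by (simp add: algebra_simps)
qed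

lift_definition uminus_circle :: "circle \<Rightarrow> circle" is "uminus"
proof -
  fix s t :: real
  assume "s - t \<in> \<int>"
  then have "- (s - t) \<in> \<int>" by (rule Ints_minus)
  then show "- s - - t \<in> \<int>" by simp
qed

lift_definition minus_circle :: "circle \<Rightarrow> circle \<Rightarrow> circle" is "(-)"
proof -
  fix s t u v :: real
  assume "s - t \<in> \<int>" "u - v \<in> \<int>"
  then have "(s - t) - (u - v) \<in> \<int>" by (rule Ints_diff)
  then show "s - u - (t - v) \<in> \<int>" by (simp add: algebra_simps)
qed

instance
  by (standard; transfer) (simp_all add: algebra_simps)

end

lemma proj_add: "proj (s + t) = proj s + proj t"
  by (simp add: plus_circle.abs_eq)

lemma proj_0: "proj 0 = 0"
  by (simp add: zero_circle.abs_eq)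

text \<open>The topology is the quotient topology.\<close>

instantiation circle :: t2_space
begin

definition open_circle :: "circle set \<Rightarrow> bool" where
  "open_circle U \<longleftrightarrow> open (proj -` U)"

lemma open_proj_image:
  assumes "open (B :: real set)"
  shows "open (proj -` (proj ` B))"
proof -
  have "proj -` (proj ` B) = (\<Union>n\<in>\<int>. (+) n ` B)"
  proof (intro equalityI subsetI)
    fix s assume "s \<in> proj -` (proj ` B)"
    then obtain b where b: "b \<in> B" "s - b \<in> \<int>" by (auto simp: proj_eq_iff)
    then have "s = (s - b) + b" by simp
    with b show "s \<in> (\<Union>n\<in>\<int>. (+) n ` B)" by blast
  next
    fix s assume "s \<in> (\<Union>n\<in>\<int>. (+) n ` B)"
    then obtain n b where "n \<in> \<int>" "b \<in> B" "s = n + b" by blast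
    then have "proj s = proj b" by (simp add: proj_eq_iff)
    with \<open>b \<in> B\<close> show "s \<in> proj -` (proj ` B)" by auto
  qed
  then show ?thesis using assms by (auto intro!: open_translation)
qed

instance
proof
  show "open (UNIV :: circle set)" by (simp add: open_circle_def)
  show "open (S \<inter> T)" if "open S" "open T" for S T :: "circle set"
    using that by (simp add: open_circle_def open_Int)
  show "open (\<Union>K)" if "\<forall>S\<in>K. open S" for K :: "circle set set"
    using that by (simp add: open_circle_def vimage_Union open_UN)
  fix x y :: circle
  assume "x \<noteq> y"
  obtain s t where st: "x = proj s" "y = proj t" using proj_surj by metis
  define d where "d = s - t"
  have d: "d \<notin> \<int>" using \<open>x \<noteq> y\<close> by (simp add: st proj_eq_iff d_def)
  define e where "e = min (frac d) (1 - frac d) / 2"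
  have e: "0 < e" using d frac_lt_1[of d] by (simp add: e_def frac_gt_0_iff)
  define U where "U = proj ` ball s e"
  define V where "V = proj ` ball t e"
  have "U \<inter> V = {}"
  proof (rule ccontr)
    assume "U \<inter> V \<noteq> {}"
    then obtain a b where ab: "a \<in> ball s e" "b \<in> ball t e" "a - b \<in> \<int>"
      by (auto simp: U_def V_def proj_eq_iff)
    then obtain m :: int where m: "a - b = of_int m" by (auto elim: Ints_cases)
    have "\<bar>of_int m - d\<bar> < 2 * e"
      using ab m by (auto simp: d_def dist_real_def)
    then have "of_int m - d < 1 - frac d" "d - of_int m < frac d"
      by (auto simp: e_def)
    then have "real_of_int m < of_int (\<lfloor>d\<rfloor> + 1)" "of_int \<lfloor>d\<rfloor> < real_of_int m"
      by (simp_all add: frac_def)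
    then have "m < \<lfloor>d\<rfloor> + 1" "\<lfloor>d\<rfloor> < m" by (simp_all only: of_int_less_iff)
    then show False by linarith
  qed
  moreover have "open U" "open V" "x \<in> U" "y \<in> V"
    using e by (auto simp: U_def V_def open_circle_def st intro: open_proj_image)
  ultimately show "\<exists>U V. open U \<and> open V \<and> x \<in> U \<and> y \<in> V \<and> U \<inter> V = {}"
    by blast
qed

end

section \<open>Maps of class $C^k$\<close>

definition Ck_real :: "nat \<Rightarrow> real set \<Rightarrow> (real \<Rightarrow> real) \<Rightarrow> bool" where
  "Ck_real k V F \<longleftrightarrow>
     (\<forall>j<k. (deriv ^^ j) F differentiable_on V) \<and> continuous_on V ((deriv ^^ k) F)"

text \<open>
  For an open set \<open>U\<close> of the circle: in the charts given by the local inverses of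
  \<^const>\<open>proj\<close>, \<open>f\<close> restricted to \<open>U\<close> is of class $C^k$. Only the values of \<open>f\<close> on
  \<open>U\<close> matter. For \<open>k = 0\<close> this is continuity on \<open>U\<close>.
\<close>

definition Ck_circle :: "nat \<Rightarrow> circle set \<Rightarrow> (circle \<Rightarrow> circle) \<Rightarrow> bool" where
  "Ck_circle k U f \<longleftrightarrow>
     (\<forall>x\<in>U. \<exists>e>0. \<exists>F. Ck_real k {-e<..<e} F \<and>
        (\<forall>s\<in>{-e<..<e}. x + proj s \<in> U \<and> f (x + proj s) = proj (F s)))"

definition Ck_diffeo :: "nat \<Rightarrow> circle set \<Rightarrow> circle set \<Rightarrow> (circle \<Rightarrow> circle) \<Rightarrow> bool" where
  "Ck_diffeo k U V f \<longleftrightarrow> open U \<and> open V \<and> bij_betw f U V \<and>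
     Ck_circle k U f \<and> Ck_circle k V (inv_into U f)"

section \<open>The group of parcelwise-$C^k$ self-transformations\<close>

text \<open>
  A diffeomorphism between cofinite subsets is represented by any total function extending
  it; since functions that agree on a cofinite set are identified, the arbitrary values at
  the finitely many remaining points do not matter, and composition of representatives is
  composition of total functions.
\<close>

definition parcelwise_Ck :: "nat \<Rightarrow> (circle \<Rightarrow> circle) set" where
  "parcelwise_Ck k = {f. \<exists>A B. finite (- A) \<and> finite (- B) \<and> Ck_diffeo k A B f}"

definition cofinite_eq :: "nat \<Rightarrow> ((circle \<Rightarrow> circle) \<times> (circle \<Rightarrow> circle)) set" where
  "cofinite_eq k = {(f, g). f \<in> parcelwise_Ck k \<and> g \<in> parcelwise_Ck k \<and>
     (\<forall>\<^sub>F x in cofinite. f x = g x)}"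

definition PC :: "nat \<Rightarrow> (circle \<Rightarrow> circle) set monoid" where
  "PC k = \<lparr>carrier = parcelwise_Ck k // cofinite_eq k,
           mult = (\<lambda>\<sigma> \<tau>. \<Union>f\<in>\<sigma>. \<Union>g\<in>\<tau>. cofinite_eq k `` {f \<circ> g}),
           one = cofinite_eq k `` {id}\<rparr>"

section \<open>The sets $K_i$ and their cardinals\<close>

definition right_lim :: "(circle \<Rightarrow> circle) \<Rightarrow> circle \<Rightarrow> circle" where
  "right_lim f x = Lim (at_right 0) (\<lambda>s. f (x + proj s))"

definition left_lim :: "(circle \<Rightarrow> circle) \<Rightarrow> circle \<Rightarrow> circle" where
  "left_lim f x = Lim (at_left 0) (\<lambda>s. f (x + proj s))"

text \<open>
  At a point where the two one-sided limits agree, \<open>right_lim f x\<close> is the value that makes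
  \<open>f\<close> continuous, so away from \<open>K\<^sub>0\<close> the function \<open>right_lim f\<close> is \<open>f\<close> extended by
  continuity. Being of class $C^i$ near \<open>x\<close> is meant in the sense of transformations: the
  extended function is a $C^i$-diffeomorphism from a neighbourhood of \<open>x\<close> onto an open set.
  Asking only that the function itself, not its local inverse, be $C^i$ would not be
  invariant under inversion: the map \<open>proj s \<mapsto> proj (4 * s ^ 3)\<close> for
  \<open>-1/2 \<le> s \<le> 1/2\<close> is parcelwise $C^1$ and everywhere $C^1$, but its inverse is not
  $C^1$ near \<open>0\<close>.
\<close>

fun K_rep :: "(circle \<Rightarrow> circle) \<Rightarrow> nat \<Rightarrow> circle set" where
  "K_rep f 0 = {x. right_lim f x \<noteq> left_lim f x}"
| "K_rep f (Suc i) = {x. (\<forall>j\<le>i. x \<notin> K_rep f j) \<and>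
     \<not> (\<exists>U V. x \<in> U \<and> Ck_diffeo (Suc i) U V (right_lim f))}"

text \<open>\<open>K_rep\<close> does not depend on the representative, by the lemma \<open>K_rep_cong\<close> below.\<close>

definition K :: "nat \<Rightarrow> (circle \<Rightarrow> circle) set \<Rightarrow> circle set" where
  "K i \<sigma> = the_elem ((\<lambda>f. K_rep f i) ` \<sigma>)"

definition k_num :: "nat \<Rightarrow> (circle \<Rightarrow> circle) set \<Rightarrow> nat" where
  "k_num i \<sigma> = card (K i \<sigma>)"

definition k_le :: "nat \<Rightarrow> (circle \<Rightarrow> circle) set \<Rightarrow> nat" where
  "k_le i \<sigma> = (\<Sum>j\<le>i. k_num j \<sigma>)"

lemma eventually_translate:
  assumes "\<forall>\<^sub>F y in cofinite. P (y :: circle)"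
  shows "\<forall>\<^sub>F s in at (0::real) within S. P (x + proj s)"
proof -
  define D where "D = {s. \<bar>s\<bar> < 1/2 \<and> \<not> P (x + proj s)}"
  have "inj_on (\<lambda>s. x + proj s) D"
  proof (rule inj_onI)
    fix s t assume "s \<in> D" "t \<in> D" "x + proj s = x + proj t"
    then have "s - t \<in> \<int>" "\<bar>s - t\<bar> < 1" by (auto simp: proj_eq_iff D_def)
    then show "s = t" using Ints_nonzero_abs_less1[of "s - t"] by auto
  qed
  moreover have "finite ((\<lambda>s. x + proj s) ` D)"
    using assms unfolding eventually_cofinite by (rule finite_subset[rotated]) (auto simp: D_def)
  ultimately have "finite D" by (rule finite_imageD[rotated])
  then have "open ({-1/2<..<1/2} - (D - {0}))"
    by (intro open_Diff finite_imp_closed) auto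
  then show ?thesis
    unfolding eventually_at_topological
    by (intro exI[of _ "{-1/2<..<1/2} - (D - {0})"]) (auto simp: D_def)
qed

lemma K_rep_cong:
  assumes "\<forall>\<^sub>F x in cofinite. f x = g x"
  shows "K_rep f i = K_rep g i"
proof -
  have "Lim (at 0 within S) (\<lambda>s. f (x + proj s)) = Lim (at 0 within S) (\<lambda>s. g (x + proj s))"
    for S x
  proof -
    have "((\<lambda>s. f (x + proj s)) \<longlongrightarrow> l) (at 0 within S) \<longleftrightarrow>
        ((\<lambda>s. g (x + proj s)) \<longlongrightarrow> l) (at 0 within S)" for l
      by (intro tendsto_cong eventually_translate assms)
    then show ?thesis by (simp add: Topological_Spaces.Lim_def)
  qed
  then have eq: "right_lim f = right_lim g" "left_lim f = left_lim g"
    by (simp_all add: right_lim_def left_lim_def fun_eq_iff)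
  show ?thesis
  proof (induction i rule: less_induct)
    case (less i)
    then show ?case by (cases i) (auto simp: eq less_Suc_eq_le)
  qed
qed

lemma K_eq_K_rep:
  assumes "\<sigma> \<in> carrier (PC k)" "f \<in> \<sigma>"
  shows "K i \<sigma> = K_rep f i"
proof -
  obtain h where h: "\<sigma> = cofinite_eq k `` {h}"
    using assms(1) by (auto simp: PC_def quotient_def)
  have "K_rep g i = K_rep h i" if "g \<in> \<sigma>" for g
    using that by (intro K_rep_cong) (auto simp: h cofinite_eq_def eq_commute)
  then have "(\<lambda>g. K_rep g i) ` \<sigma> = {K_rep f i}"
    using assms(2) by auto
  then show ?thesis by (simp add: K_def)
qed

definition grows_linearly :: "(int \<Rightarrow> nat) \<Rightarrow> bool" where
  "grows_linearly u \<longleftrightarrow> (\<exists>c>0. \<exists>C. \<forall>n. \<bar>real (u n) - c * \<bar>real_of_int n\<bar>\<bar> \<le> C)"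

end

(* A parcelwise-C^k transformation acts as a genuine permutation on the set of one-sided germs of
   neighbourhoods of points of the circle. Counting the germs over the singular points shows that a
   transformation and its inverse have equally many singular points of class at most i.

   The regular points of the powers of a transformation form a partial action of the integers in
   which every power is defined off a finite set. Sort the singular points x of the n-th power by
   the singular point d of the first power at which the orbit of x is last defined before time n.
   For fixed d, either the orbit of d becomes defined again and the number of such x is bounded, or
   the backward orbit of d is eventually always defined or eventually never defined, and the number
   of such x is n or 0 up to a bounded error. So the count is m n + O(1), and as it is subadditive
   in n, the error is non-negative. *)

theory Submission
  imports Defs
begin

section \<open>Real functions of class $C^k$\<close>

text \<open>Singular points cannot simply be followed along orbits: a point singular for one power
  may be regular for a higher one, because breaks can cancel, and a jump has no single image. Hence
  regularity is phrased as agreement, up to finitely many points, with some local C^i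
  diffeomorphism. This passes to composites and inverses, ignores the choice of representatives, and
  its failure is membership in one of K_0, ..., K_i. Inverses are compared one side at a time
  because a jump sends the two sides of a point to different points.

  The dichotomy for the backward orbit of d holds because each passage from undefined to defined
  happens at a singular point of the first power; if the forward orbit of d never becomes defined
  again, these points are distinct, so there are finitely many passages. Subadditivity excludes a
  negative error because a deficit of 1 at n becomes a deficit of j at j n, which exceeds any
  bound.\<close>

lemma Ck_real_0: "Ck_real 0 S F \<longleftrightarrow> continuous_on S F"
  by (simp add: Ck_real_def)

text \<open>Peels off the innermost derivative, so that inductions on the class can apply their
  hypothesis to \<open>deriv F\<close>.\<close>

lemma Ck_real_Suc:
  "Ck_real (Suc k) S F \<longleftrightarrow> F differentiable_on S \<and> Ck_real k S (deriv F)"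
  by (auto simp: Ck_real_def less_Suc_eq_0_disj funpow_Suc_right simp del: funpow.simps(2))

lemma Ck_real_Suc_imp: "Ck_real (Suc k) S F \<Longrightarrow> Ck_real k S F"
  by (auto simp: Ck_real_def intro: differentiable_imp_continuous_on)

lemma Ck_real_antimono: "Ck_real k S F \<Longrightarrow> i \<le> k \<Longrightarrow> Ck_real i S F"
  by (induction k) (auto simp: le_Suc_eq dest: Ck_real_Suc_imp)

lemma Ck_real_imp_continuous_on: "Ck_real k S F \<Longrightarrow> continuous_on S F"
  using Ck_real_antimono[of k S F 0] by (simp add: Ck_real_0)

lemma Ck_real_subset: "Ck_real k S F \<Longrightarrow> T \<subseteq> S \<Longrightarrow> Ck_real k T F"
  by (auto simp: Ck_real_def intro: differentiable_on_subset continuous_on_subset)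

lemma deriv_eq_on_open:
  fixes F G :: "real \<Rightarrow> real"
  assumes "open S" "\<And>x. x \<in> S \<Longrightarrow> F x = G x" "x \<in> S"
  shows "deriv F x = deriv G x"
  using assms by (intro deriv_cong_ev refl eventually_nhds_in_open[THEN eventually_mono]) auto

text \<open>Openness enters because \<open>deriv\<close> looks at a full neighbourhood of the point,
  not only at the values on \<open>S\<close>.\<close>

lemma Ck_real_cong:
  assumes "open S" "Ck_real k S F" "\<And>x. x \<in> S \<Longrightarrow> F x = G x"
  shows "Ck_real k S G"
  using assms(2,3)
proof (induction k arbitrary: F G)
  case 0
  then show ?case by (simp add: Ck_real_0 cong: continuous_on_cong)
next
  case (Suc k)
  have "G differentiable_on S"
    unfolding differentiable_on_def
  proof
    fix x assume "x \<in> S"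
    with Suc.prems(1) have "F differentiable at x within S"
      by (simp add: Ck_real_Suc differentiable_on_def)
    then show "G differentiable at x within S"
      by (rule differentiable_transform_within[OF _ zero_less_one \<open>x \<in> S\<close>]) (rule Suc.prems(2))
  qed
  moreover have "Ck_real k S (deriv G)"
  proof (rule Suc.IH)
    show "Ck_real k S (deriv F)" using Suc.prems(1) by (simp add: Ck_real_Suc)
    show "deriv F x = deriv G x" if "x \<in> S" for x
      using assms(1) Suc.prems(2) that by (rule deriv_eq_on_open)
  qed
  ultimately show ?case by (simp add: Ck_real_Suc)
qed

lemma differentiable_on_open_has_deriv:
  fixes F :: "real \<Rightarrow> real"
  assumes "F differentiable_on S" "open S" "x \<in> S"
  shows "(F has_field_derivative deriv F x) (at x)"
  using assms by (metis DERIV_deriv_iff_real_differentiable at_within_open differentiable_on_def)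

lemma Ck_real_add:
  assumes "open S" "Ck_real k S F" "Ck_real k S G"
  shows "Ck_real k S (\<lambda>x. F x + G x)"
  using assms(2,3)
proof (induction k arbitrary: F G)
  case 0
  then show ?case by (simp add: Ck_real_0 continuous_on_add)
next
  case (Suc k)
  then have d: "F differentiable_on S" "G differentiable_on S"
    and c: "Ck_real k S (\<lambda>x. deriv F x + deriv G x)" by (auto simp: Ck_real_Suc)
  have "deriv F x + deriv G x = deriv (\<lambda>x. F x + G x) x" if "x \<in> S" for x
    using d that assms(1)
    by (intro DERIV_imp_deriv[symmetric] DERIV_add differentiable_on_open_has_deriv)
  with c d show ?case
    by (simp add: Ck_real_Suc differentiable_on_add Ck_real_cong[OF assms(1)])
qed

lemma Ck_real_mult:
  assumes "open S" "Ck_real k S F" "Ck_real k S G"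
  shows "Ck_real k S (\<lambda>x. F x * G x)"
  using assms(2,3)
proof (induction k arbitrary: F G)
  case 0
  then show ?case by (simp add: Ck_real_0 continuous_on_mult)
next
  case (Suc k)
  then have d: "F differentiable_on S" "G differentiable_on S"
    and "Ck_real k S (deriv F)" "Ck_real k S (deriv G)" by (auto simp: Ck_real_Suc)
  then have c: "Ck_real k S (\<lambda>x. deriv F x * G x + deriv G x * F x)"
    using Suc.prems[THEN Ck_real_Suc_imp] by (intro Ck_real_add assms(1) Suc.IH)
  have "deriv F x * G x + deriv G x * F x = deriv (\<lambda>x. F x * G x) x" if "x \<in> S" for x
    using d that assms(1)
    by (intro DERIV_imp_deriv[symmetric] DERIV_mult differentiable_on_open_has_deriv)
  with c d show ?case
    by (simp add: Ck_real_Suc differentiable_on_mult Ck_real_cong[OF assms(1)])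
qed

text \<open>Chain rule: the derivative is \<open>deriv G (F x) * deriv F x\<close>, and the
  induction hypothesis is applied to \<open>deriv G\<close> with the same \<open>F\<close>.\<close>

lemma Ck_real_compose:
  assumes "open S" "open T" "Ck_real k S F" "Ck_real k T G" "F ` S \<subseteq> T"
  shows "Ck_real k S (\<lambda>x. G (F x))"
  using assms(3,4)
proof (induction k arbitrary: G)
  case 0
  then show ?case using assms(5) by (auto simp: Ck_real_0 intro: continuous_on_compose2)
next
  case (Suc k)
  then have d: "F differentiable_on S" "G differentiable_on T"
    and "Ck_real k S (deriv F)" "Ck_real k T (deriv G)" by (auto simp: Ck_real_Suc)
  then have c: "Ck_real k S (\<lambda>x. deriv G (F x) * deriv F x)"
    using Suc.prems(1)[THEN Ck_real_Suc_imp] by (intro Ck_real_mult assms(1) Suc.IH[of "deriv G"])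
  have *: "((\<lambda>x. G (F x)) has_field_derivative deriv G (F x) * deriv F x) (at x)"
    if "x \<in> S" for x
    by (rule DERIV_chain2[OF differentiable_on_open_has_deriv[OF d(2) assms(2)]
          differentiable_on_open_has_deriv[OF d(1) assms(1)]]) (use that assms(5) in auto)
  then have "(\<lambda>x. G (F x)) differentiable_on S"
    unfolding differentiable_on_def real_differentiable_def
    by (blast intro: has_field_derivative_at_within)
  moreover have "Ck_real k S (deriv (\<lambda>x. G (F x)))"
    using DERIV_imp_deriv[OF *] by (intro Ck_real_cong[OF assms(1) c]) auto
  ultimately show ?case by (simp add: Ck_real_Suc)
qed

lemma Ck_real_const: "Ck_real k S (\<lambda>x. c)"
  by (induction k arbitrary: c) (auto simp: Ck_real_0 Ck_real_Suc)

lemma Ck_real_id: "Ck_real k S (\<lambda>x. x)"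
  by (cases k) (auto simp: Ck_real_0 Ck_real_Suc Ck_real_const)

lemma Ck_real_translate:
  assumes "Ck_real k (ball b e) F"
  shows "Ck_real k (ball a e) (\<lambda>s. F (s + (b - a)))"
  by (rule Ck_real_compose[OF _ _ _ assms])
     (auto intro!: Ck_real_add Ck_real_id Ck_real_const simp: dist_real_def)

section \<open>Local lifts and diffeomorphisms of the circle\<close>

lemma open_image_proj: "open B \<Longrightarrow> open (proj ` B)"
  by (simp add: open_circle_def open_proj_image)

lemma continuous_on_proj: "continuous_on S proj"
  by (rule continuous_on_subset[of UNIV])
     (auto simp: continuous_on_open_vimage open_circle_def)

text \<open>Continuity of \<open>proj\<close> gives one inequality of filters, openness the other.
  Continuity on the circle can therefore be tested after composing with \<open>proj\<close>.\<close>

lemma nhds_proj: "nhds (proj a) = filtermap proj (nhds a)"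
proof (rule antisym)
  show "filtermap proj (nhds a) \<le> nhds (proj a)"
    using continuous_on_proj[of UNIV]
    by (simp add: continuous_on_eq_continuous_at isCont_def tendsto_at_iff_tendsto_nhds flip: filterlim_def)
  show "nhds (proj a) \<le> filtermap proj (nhds a)"
  proof (rule filter_leI)
    fix P assume "eventually P (filtermap proj (nhds a))"
    then obtain B where "open B" "a \<in> B" "\<forall>s\<in>B. P (proj s)"
      by (auto simp: eventually_filtermap eventually_nhds)
    then show "eventually P (nhds (proj a))"
      unfolding eventually_nhds by (intro exI[of _ "proj ` B"]) (auto intro: open_image_proj)
  qed
qed

lemma isCont_circle: "isCont f (proj a) \<longleftrightarrow> isCont (\<lambda>s. f (proj s)) a"
  using tendsto_at_iff_tendsto_nhds[of f "proj a"] tendsto_at_iff_tendsto_nhds[of "\<lambda>s. f (proj s)" a]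
  by (simp add: isCont_def nhds_proj filterlim_filtermap)

lemma tendsto_proj: "(f \<longlongrightarrow> a) F \<Longrightarrow> ((\<lambda>x. proj (f x)) \<longlongrightarrow> proj a) F"
  by (rule continuous_on_tendsto_compose[OF continuous_on_proj[of UNIV]]) auto

text \<open>Embeds the circle as the unit circle of the complex plane, so that real lifts can be
  read off from continuous logarithms.\<close>

lift_definition circle_cis :: "circle \<Rightarrow> complex" is "\<lambda>t. cis (2 * pi * t)"
proof -
  fix s t :: real assume "s - t \<in> \<int>"
  then have "cis (2 * pi * (s - t)) = 1" by (rule cis_multiple_2pi)
  then show "cis (2 * pi * s) = cis (2 * pi * t)"
    by (simp add: right_diff_distrib flip: cis_divide)
qed

lemma circle_cis_inject: "circle_cis x = circle_cis y \<Longrightarrow> x = y"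
proof transfer
  fix s t assume "cis (2 * pi * s) = cis (2 * pi * t)"
  then obtain n :: int where "\<i> * (2 * pi * s) = \<i> * (2 * pi * t) + (of_int (2 * n) * pi) * \<i>"
    unfolding cis_conv_exp exp_eq by auto
  then have "\<i> * complex_of_real (2 * pi * s) = \<i> * complex_of_real (2 * pi * t + of_int (2 * n) * pi)"
    by (simp add: algebra_simps)
  then have "2 * pi * s = 2 * pi * t + of_int (2 * n) * pi"
    by (metis complex_i_not_zero mult_cancel_left of_real_eq_iff)
  then have "2 * pi * (s - t) = 2 * pi * of_int n" by (simp add: algebra_simps)
  then have "s - t = of_int n" by simp
  then show "s - t \<in> \<int>" by simp
qed

lemma continuous_on_circle_cis: "continuous_on S circle_cis"
proof -
  have "isCont circle_cis x" for x
  proof -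
    obtain a where "x = proj a" using proj_surj by blast
    then show ?thesis
      by (auto simp: isCont_circle circle_cis.abs_eq cis_conv_exp intro!: continuous_intros)
  qed
  then show ?thesis by (simp add: continuous_at_imp_continuous_on)
qed

text \<open>\<open>circle_cis (h s)\<close> never vanishes on the contractible set \<open>S\<close>,
  so it has a continuous logarithm. Its modulus is 1, so the logarithm is purely imaginary, and its
  imaginary part divided by 2 pi is a lift.\<close>

lemma lift_to_real:
  fixes h :: "real \<Rightarrow> circle"
  assumes "continuous_on S h" "convex S"
  obtains F where "continuous_on S F" "\<And>s. s \<in> S \<Longrightarrow> h s = proj (F s)"
proof -
  have "continuous_on S (\<lambda>s. circle_cis (h s))"
    using assms(1) continuous_on_circle_cis[of UNIV] by (auto intro: continuous_on_compose2)
  moreover have nz: "norm (circle_cis x) = 1" for x by transfer simp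
  ultimately obtain g where g: "continuous_on S g" "\<And>s. s \<in> S \<Longrightarrow> circle_cis (h s) = exp (g s)"
    using continuous_logarithm_on_contractible[OF _ convex_imp_contractible[OF assms(2)],
        of "\<lambda>s. circle_cis (h s)"] by (metis norm_zero zero_neq_one)
  show ?thesis
  proof (rule that[of "\<lambda>s. Im (g s) / (2 * pi)"])
    show "continuous_on S (\<lambda>s. Im (g s) / (2 * pi))"
      by (intro continuous_intros g) auto
    fix s assume s: "s \<in> S"
    have "exp (Re (g s)) = 1" using nz[of "h s"] g(2)[OF s] by simp
    then have "exp (g s) = cis (Im (g s))" by (simp add: exp_eq_polar)
    then have "circle_cis (h s) = circle_cis (proj (Im (g s) / (2 * pi)))"
      by (simp add: g(2)[OF s] circle_cis.abs_eq)
    then show "h s = proj (Im (g s) / (2 * pi))" by (rule circle_cis_inject)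
  qed
qed

text \<open>Recentres the charts at an arbitrary real lift of the point, which makes the local lifts
  of two maps directly composable.\<close>

lemma Ck_circle_iff:
  "Ck_circle k U f \<longleftrightarrow> (\<forall>a. proj a \<in> U \<longrightarrow> (\<exists>e>0. \<exists>F. Ck_real k (ball a e) F \<and>
     (\<forall>s\<in>ball a e. proj s \<in> U \<and> f (proj s) = proj (F s))))" (is "_ \<longleftrightarrow> ?R")
proof
  assume L: "Ck_circle k U f"
  show ?R
  proof (intro allI impI)
    fix a assume "proj a \<in> U"
    then obtain e F where eF: "e > 0" "Ck_real k (ball 0 e) F"
        "\<And>s. s \<in> ball 0 e \<Longrightarrow> proj a + proj s \<in> U \<and> f (proj a + proj s) = proj (F s)"
      using L unfolding Ck_circle_def by (auto simp: ball_eq_greaterThanLessThan)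
    have "proj s \<in> U \<and> f (proj s) = proj (F (s + (0 - a)))" if "s \<in> ball a e" for s
      using eF(3)[of "s - a"] that by (auto simp: dist_real_def simp flip: proj_add)
    with eF(1) Ck_real_translate[OF eF(2), of a]
    show "\<exists>e>0. \<exists>F. Ck_real k (ball a e) F \<and> (\<forall>s\<in>ball a e. proj s \<in> U \<and> f (proj s) = proj (F s))"
      by blast
  qed
next
  assume R: ?R
  show "Ck_circle k U f"
    unfolding Ck_circle_def
  proof
    fix x assume "x \<in> U"
    moreover obtain a where x: "x = proj a" using proj_surj by blast
    ultimately obtain e F where eF: "e > 0" "Ck_real k (ball a e) F"
        "\<And>s. s \<in> ball a e \<Longrightarrow> proj s \<in> U \<and> f (proj s) = proj (F s)"
      using R by blast
    have "x + proj s \<in> U \<and> f (x + proj s) = proj (F (s + (a - 0)))" if "s \<in> ball 0 e" for s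
      using eF(3)[of "a + s"] that by (auto simp: dist_real_def x add.commute simp flip: proj_add)
    moreover have "{-e<..<e} = ball 0 e" by (simp add: ball_eq_greaterThanLessThan)
    ultimately show "\<exists>e>0. \<exists>F. Ck_real k {-e<..<e} F \<and>
        (\<forall>s\<in>{-e<..<e}. x + proj s \<in> U \<and> f (x + proj s) = proj (F s))"
      using eF(1) Ck_real_translate[OF eF(2), of 0] by metis
  qed
qed

lemma Ck_circle_antimono: "Ck_circle k U f \<Longrightarrow> i \<le> k \<Longrightarrow> Ck_circle i U f"
  unfolding Ck_circle_def by (meson Ck_real_antimono)

lemma Ck_circle_cong: "Ck_circle k U f \<Longrightarrow> (\<And>x. x \<in> U \<Longrightarrow> f x = g x) \<Longrightarrow> Ck_circle k U g"
  unfolding Ck_circle_def by metis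

lemma Ck_circle_compose:
  assumes f: "Ck_circle k U f" and g: "Ck_circle k V g"
  shows "Ck_circle k (U \<inter> f -` V) (\<lambda>x. g (f x))"
  unfolding Ck_circle_iff
proof (intro allI impI)
  fix a assume a: "proj a \<in> U \<inter> f -` V"
  then obtain e F where F: "e > 0" "Ck_real k (ball a e) F"
      "\<And>s. s \<in> ball a e \<Longrightarrow> proj s \<in> U \<and> f (proj s) = proj (F s)"
    using f unfolding Ck_circle_iff by blast
  then have "proj (F a) \<in> V" using a by auto
  then obtain d G where G: "d > 0" "Ck_real k (ball (F a) d) G"
      "\<And>s. s \<in> ball (F a) d \<Longrightarrow> proj s \<in> V \<and> g (proj s) = proj (G s)"
    using g unfolding Ck_circle_iff by blast
  have "isCont F a"
    using Ck_real_imp_continuous_on[OF F(2)] F(1) by (simp add: continuous_on_eq_continuous_at)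
  then obtain r where r: "r > 0" "\<And>s. dist s a < r \<Longrightarrow> dist (F s) (F a) < d"
    using G(1) unfolding continuous_at_eps_delta by blast
  define q where "q = min e r"
  have q: "q > 0" "ball a q \<subseteq> ball a e" "F ` ball a q \<subseteq> ball (F a) d"
    using F(1) r by (auto simp: q_def dist_commute)
  have "Ck_real k (ball a q) (\<lambda>s. G (F s))"
    by (rule Ck_real_compose[OF _ _ Ck_real_subset[OF F(2) q(2)] G(2) q(3)]) auto
  moreover have "proj s \<in> U \<inter> f -` V \<and> g (f (proj s)) = proj (G (F s))" if "s \<in> ball a q" for s
  proof -
    have "s \<in> ball a e" "F s \<in> ball (F a) d" using q(2,3) that by blast+
    with F(3)[of s] G(3)[of "F s"] show ?thesis by auto
  qed
  ultimately show "\<exists>e>0. \<exists>F. Ck_real k (ball a e) F \<and>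
      (\<forall>s\<in>ball a e. proj s \<in> U \<inter> f -` V \<and> g (f (proj s)) = proj (F s))"
    using q(1) by (intro exI[of _ q] exI[of _ "\<lambda>s. G (F s)"]) auto
qed

lemma Ck_circle_ident: "open U \<Longrightarrow> Ck_circle k U (\<lambda>x. x)"
  unfolding Ck_circle_iff
proof (intro allI impI)
  fix a assume "open U" "proj a \<in> U"
  then obtain e where "e > 0" "ball a e \<subseteq> proj -` U"
    unfolding open_circle_def by (metis openE vimage_eq)
  then show "\<exists>e>0. \<exists>F. Ck_real k (ball a e) F \<and> (\<forall>s\<in>ball a e. proj s \<in> U \<and> proj s = proj (F s))"
    using Ck_real_id[of k "ball a e"] by (intro exI[of _ e] conjI exI[of _ "\<lambda>s. s"]) auto
qed

lemma Ck_circle_imp_continuous_on: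
  assumes "Ck_circle k U f"
  shows "continuous_on U f"
proof (rule continuous_at_imp_continuous_on, rule ballI)
  fix x assume "x \<in> U"
  moreover obtain a where x: "x = proj a" using proj_surj by blast
  ultimately obtain e F where F: "e > 0" "Ck_real k (ball a e) F"
      "\<And>s. s \<in> ball a e \<Longrightarrow> f (proj s) = proj (F s)"
    using assms unfolding Ck_circle_iff by blast
  have "continuous_on (ball a e) (\<lambda>s. proj (F s))"
    by (rule continuous_on_compose2[OF continuous_on_proj[of UNIV] Ck_real_imp_continuous_on[OF F(2)]]) simp
  then have "continuous_on (ball a e) (\<lambda>s. f (proj s))"
    by (rule continuous_on_eq) (simp add: F(3))
  then show "isCont f x"
    using F(1) by (simp add: x isCont_circle continuous_on_eq_continuous_at)
qed

lemma continuous_on_imp_Ck_circle_0: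
  assumes "open U" "continuous_on U f"
  shows "Ck_circle 0 U f"
  unfolding Ck_circle_iff
proof (intro allI impI)
  fix a assume "proj a \<in> U"
  then obtain e where e: "e > 0" "ball a e \<subseteq> proj -` U"
    using assms(1) unfolding open_circle_def by (metis openE vimage_eq)
  have "continuous_on (ball a e) (\<lambda>s. f (proj s))"
    using assms(2) e(2) by (intro continuous_on_compose2[OF _ continuous_on_proj]) auto
  then obtain F where "continuous_on (ball a e) F" "\<And>s. s \<in> ball a e \<Longrightarrow> f (proj s) = proj (F s)"
    using lift_to_real convex_ball by metis
  then show "\<exists>e>0. \<exists>F. Ck_real 0 (ball a e) F \<and>
      (\<forall>s\<in>ball a e. proj s \<in> U \<and> f (proj s) = proj (F s))"
    using e by (intro exI[of _ e] exI[of _ F]) (auto simp: Ck_real_0)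
qed

section \<open>Diffeomorphisms between open sets\<close>

lemma Ck_diffeoI:
  assumes "open U" "open V" "Ck_circle k U f" "Ck_circle k V h"
    and U: "\<And>x. x \<in> U \<Longrightarrow> f x \<in> V \<and> h (f x) = x"
    and V: "\<And>y. y \<in> V \<Longrightarrow> h y \<in> U \<and> f (h y) = y"
  shows "Ck_diffeo k U V f"
proof -
  have bij: "bij_betw f U V"
    using U V by (intro bij_betw_byWitness[where f' = h]) auto
  have "h y = inv_into U f y" if "y \<in> V" for y
    using bij V[OF that] by (metis bij_betw_inv_into_left)
  then have "Ck_circle k V (inv_into U f)" by (rule Ck_circle_cong[OF assms(4)])
  with bij assms show ?thesis by (simp add: Ck_diffeo_def)
qed

text \<open>Together with \<open>Ck_diffeoI\<close> this trades \<open>inv_into\<close> for an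
  explicit inverse \<open>h\<close>. The resulting conditions are symmetric, so exchanging
  \<open>U\<close> and \<open>V\<close>, \<open>f\<close> and \<open>h\<close> gives the inverse
  diffeomorphism.\<close>

lemma Ck_diffeoE:
  assumes "Ck_diffeo k U V f"
  obtains h where "open U" "open V" "Ck_circle k U f" "Ck_circle k V h"
    "\<And>x. x \<in> U \<Longrightarrow> f x \<in> V \<and> h (f x) = x" "\<And>y. y \<in> V \<Longrightarrow> h y \<in> U \<and> f (h y) = y"
proof (rule that[of "inv_into U f"])
  have "bij_betw f U V" using assms by (simp add: Ck_diffeo_def)
  then show "f x \<in> V \<and> inv_into U f (f x) = x" if "x \<in> U" for x
    using that by (auto simp: bij_betw_inv_into_left bij_betw_apply)
  show "inv_into U f y \<in> U \<and> f (inv_into U f y) = y" if "y \<in> V" for y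
    using that \<open>bij_betw f U V\<close> by (auto simp: bij_betw_inv_into_right bij_betw_def inv_into_into)
qed (use assms in \<open>auto simp: Ck_diffeo_def\<close>)

lemma Ck_diffeo_antimono: "Ck_diffeo k U V f \<Longrightarrow> i \<le> k \<Longrightarrow> Ck_diffeo i U V f"
  by (auto simp: Ck_diffeo_def intro: Ck_circle_antimono)

lemma Ck_diffeo_cong:
  assumes "Ck_diffeo k U V f" "\<And>x. x \<in> U \<Longrightarrow> f x = g x"
  shows "Ck_diffeo k U V g"
proof -
  from assms(1) obtain h where h: "open U" "open V" "Ck_circle k U f" "Ck_circle k V h"
    "\<And>x. x \<in> U \<Longrightarrow> f x \<in> V \<and> h (f x) = x" "\<And>y. y \<in> V \<Longrightarrow> h y \<in> U \<and> f (h y) = y"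
    by (rule Ck_diffeoE) blast
  show ?thesis
    by (rule Ck_diffeoI[OF h(1,2) Ck_circle_cong[OF h(3)] h(4)]) (use h assms(2) in \<open>metis\<close>)+
qed

text \<open>The formula for \<open>W\<close> is what shows in \<open>parcelwise_compose\<close> that
  the image of a composite is cofinite.\<close>

lemma Ck_diffeo_compose:
  assumes f: "Ck_diffeo k U V f" and g: "Ck_diffeo k U' V' g"
  obtains W where "Ck_diffeo k (U \<inter> f -` U') W (\<lambda>x. g (f x))" "W = g ` (V \<inter> U')"
proof -
  from f obtain h where h: "open U" "open V" "Ck_circle k U f" "Ck_circle k V h"
    "\<And>x. x \<in> U \<Longrightarrow> f x \<in> V \<and> h (f x) = x" "\<And>y. y \<in> V \<Longrightarrow> h y \<in> U \<and> f (h y) = y"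
    by (rule Ck_diffeoE) blast
  from g obtain q where q: "open U'" "open V'" "Ck_circle k U' g" "Ck_circle k V' q"
    "\<And>x. x \<in> U' \<Longrightarrow> g x \<in> V' \<and> q (g x) = x" "\<And>y. y \<in> V' \<Longrightarrow> q y \<in> U' \<and> g (q y) = y"
    by (rule Ck_diffeoE) blast
  have "Ck_diffeo k (U \<inter> f -` U') (V' \<inter> q -` V) (\<lambda>x. g (f x))"
  proof (rule Ck_diffeoI[of _ _ _ _ "\<lambda>y. h (q y)"])
    show "open (U \<inter> f -` U')"
      using h q by (intro continuous_open_preimage Ck_circle_imp_continuous_on)
    show "open (V' \<inter> q -` V)"
      using h q by (intro continuous_open_preimage Ck_circle_imp_continuous_on)
    show "Ck_circle k (U \<inter> f -` U') (\<lambda>x. g (f x))" by (rule Ck_circle_compose[OF h(3) q(3)])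
    show "Ck_circle k (V' \<inter> q -` V) (\<lambda>x. h (q x))" by (rule Ck_circle_compose[OF q(4) h(4)])
  qed (use h q in auto)
  moreover have "V' \<inter> q -` V = g ` (V \<inter> U')" using q by force
  ultimately show ?thesis using that by blast
qed

text \<open>Invariance of domain is applied to local real lifts and pushed down by the open map
  \<open>proj\<close>. Openness of the images of all open subsets of \<open>U\<close> is continuity
  of the inverse.\<close>

lemma continuous_inj_imp_C0_diffeo:
  assumes "open U" "continuous_on U f" "inj_on f U"
  shows "Ck_diffeo 0 U (f ` U) f"
proof -
  have op: "open (f ` W)" if W: "open W" "W \<subseteq> U" for W
  proof (subst open_subopen, rule ballI)
    fix y assume "y \<in> f ` W"
    then obtain a where a: "proj a \<in> W" "y = f (proj a)" using proj_surj by (metis imageE)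
    have "Ck_circle 0 W f"
      using W assms(2) by (auto intro: continuous_on_imp_Ck_circle_0 continuous_on_subset)
    then obtain e F where F: "e > 0" "Ck_real 0 (ball a e) F"
        "\<And>s. s \<in> ball a e \<Longrightarrow> proj s \<in> W \<and> f (proj s) = proj (F s)"
      using a(1) unfolding Ck_circle_iff by blast
    \<comment> \<open>Two points of an open interval of length at most 1 differ by less than 1, so
      \<open>proj\<close> is injective on \<open>B\<close> and injectivity of \<open>f\<close>
      passes to \<open>F\<close>.\<close>
    define B where "B = ball a (min e (1/2))"
    have "inj_on F B"
    proof (rule inj_onI)
      fix s t assume st: "s \<in> B" "t \<in> B" "F s = F t"
      then have "f (proj s) = f (proj t)" "proj s \<in> U" "proj t \<in> U"
        using F(3)[of s] F(3)[of t] W(2) by (auto simp: B_def)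
      then have "proj s = proj t" by (rule inj_onD[OF assms(3)])
      then have "s - t \<in> \<int>" by (simp add: proj_eq_iff)
      moreover have "\<bar>s - t\<bar> < 1" using st by (simp add: B_def dist_real_def abs_if split: if_splits)
      ultimately show "s = t" using Ints_nonzero_abs_less1[of "s - t"] by auto
    qed
    moreover have "continuous_on B F"
      using F(2) unfolding Ck_real_0 by (rule continuous_on_subset) (auto simp: B_def)
    ultimately have "open (proj ` F ` B)"
      by (intro open_image_proj invariance_of_domain) (auto simp: B_def)
    moreover have "y \<in> proj ` F ` B" using F a by (auto simp: B_def intro!: imageI)
    moreover have "proj ` F ` B \<subseteq> f ` W"
    proof
      fix z assume "z \<in> proj ` F ` B"
      then obtain s where "s \<in> B" "z = proj (F s)" by auto
      then show "z \<in> f ` W" using F(3)[of s] by (auto simp: B_def intro!: image_eqI[of _ f "proj s"])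
    qed
    ultimately show "\<exists>T. open T \<and> y \<in> T \<and> T \<subseteq> f ` W" by blast
  qed
  have "continuous_on (f ` U) (inv_into U f)"
    unfolding continuous_on_open_invariant
  proof (intro allI impI)
    fix B :: "circle set" assume "open B"
    then have "open (f ` (U \<inter> B))" using assms(1) by (intro op) auto
    moreover have "f ` (U \<inter> B) \<inter> f ` U = inv_into U f -` B \<inter> f ` U"
      by (auto simp: inv_into_f_f[OF assms(3)] dest: inj_onD[OF assms(3)])
    ultimately show "\<exists>A. open A \<and> A \<inter> f ` U = inv_into U f -` B \<inter> f ` U" by blast
  qed
  then show ?thesis
    using assms op[of U]
    by (auto simp: Ck_diffeo_def bij_betw_def intro!: continuous_on_imp_Ck_circle_0)
qed

section \<open>The group of parcelwise transformations\<close>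

lemma parcelwise_CkE:
  assumes "f \<in> parcelwise_Ck k"
  obtains A B where "finite (- A)" "finite (- B)" "Ck_diffeo k A B f"
  using assms by (auto simp: parcelwise_Ck_def)

text \<open>Injectivity off a finite set makes preimages of finite sets finite. Properties valid off
  a finite set can thus be pulled back along \<open>f\<close>.\<close>

lemma parcelwise_filterlim_cofinite:
  assumes "f \<in> parcelwise_Ck k"
  shows "filterlim f cofinite cofinite"
proof -
  from assms obtain A B where AB: "finite (- A)" "finite (- B)" "Ck_diffeo k A B f"
    by (rule parcelwise_CkE)
  have inj: "inj_on f A" using AB(3) by (auto simp: Ck_diffeo_def bij_betw_def)
  show ?thesis
    unfolding filterlim_iff eventually_cofinite
  proof (intro allI impI)
    fix P :: "circle \<Rightarrow> bool" assume "finite {x. \<not> P x}"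
    then have "finite (f -` {x. \<not> P x} \<inter> A)" using inj by (rule finite_vimage_IntI)
    moreover have "{x. \<not> P (f x)} \<subseteq> (f -` {x. \<not> P x} \<inter> A) \<union> - A" by auto
    ultimately show "finite {x. \<not> P (f x)}" using AB(1) finite_subset by blast
  qed
qed

lemma parcelwise_eventually:
  "f \<in> parcelwise_Ck k \<Longrightarrow> \<forall>\<^sub>F y in cofinite. P y \<Longrightarrow> \<forall>\<^sub>F x in cofinite. P (f x)"
  using parcelwise_filterlim_cofinite by (auto simp: filterlim_iff)

lemma parcelwise_compose:
  assumes f: "f \<in> parcelwise_Ck k" and g: "g \<in> parcelwise_Ck k"
  shows "f \<circ> g \<in> parcelwise_Ck k"
proof -
  from g obtain A B where AB: "finite (- A)" "finite (- B)" "Ck_diffeo k A B g"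
    by (rule parcelwise_CkE)
  from f obtain C D where CD: "finite (- C)" "finite (- D)" "Ck_diffeo k C D f"
    by (rule parcelwise_CkE)
  from Ck_diffeo_compose[OF AB(3) CD(3)] obtain W
    where W: "Ck_diffeo k (A \<inter> g -` C) W (\<lambda>x. f (g x))" "W = f ` (B \<inter> C)" .
  have "\<forall>\<^sub>F x in cofinite. x \<in> A \<inter> g -` C"
    using parcelwise_eventually[OF g, of "\<lambda>y. y \<in> C"] AB(1) CD(1)
    by (simp add: eventually_conj_iff eventually_cofinite Compl_eq)
  then have "finite (- (A \<inter> g -` C))" by (simp add: eventually_cofinite Compl_eq)
  \<comment> \<open>A point of \<open>D\<close> outside \<open>W\<close> is the image of a point of
    \<open>C\<close> that lies outside \<open>B\<close>.\<close>
  moreover have "finite (- W)"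
  proof (rule finite_subset)
    show "- W \<subseteq> - D \<union> f ` (- B)"
      using CD(3) by (auto simp: W(2) Ck_diffeo_def bij_betw_def)
  qed (use AB CD in simp)
  ultimately show ?thesis
    using W(1) unfolding parcelwise_Ck_def o_def by blast
qed

lemma parcelwise_id: "id \<in> parcelwise_Ck k"
proof -
  have "Ck_diffeo k UNIV UNIV (\<lambda>x. x)"
    by (rule Ck_diffeoI[where h = "\<lambda>x. x"]) (auto intro: Ck_circle_ident)
  then have "\<exists>A B. finite (- A) \<and> finite (- B) \<and> Ck_diffeo k A B (\<lambda>x. x)"
    by (intro exI[of _ UNIV]) auto
  then show ?thesis by (simp add: parcelwise_Ck_def id_def)
qed

lemma parcelwise_inverse:
  assumes "f \<in> parcelwise_Ck k"
  obtains h where "h \<in> parcelwise_Ck k" "\<forall>\<^sub>F x in cofinite. h (f x) = x"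
proof -
  from assms obtain A B where AB: "finite (- A)" "finite (- B)" "Ck_diffeo k A B f"
    by (rule parcelwise_CkE)
  from AB(3) obtain h where h: "open A" "open B" "Ck_circle k A f" "Ck_circle k B h"
    "\<And>x. x \<in> A \<Longrightarrow> f x \<in> B \<and> h (f x) = x" "\<And>y. y \<in> B \<Longrightarrow> h y \<in> A \<and> f (h y) = y"
    by (rule Ck_diffeoE) blast
  have "Ck_diffeo k B A h" by (rule Ck_diffeoI[OF h(2,1,4,3,6,5)])
  then have "h \<in> parcelwise_Ck k" using AB by (auto simp: parcelwise_Ck_def)
  moreover have "finite {x. h (f x) \<noteq> x}"
    by (rule finite_subset[OF _ AB(1)]) (use h(5) in auto)
  then have "\<forall>\<^sub>F x in cofinite. h (f x) = x" by (simp add: eventually_cofinite)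
  ultimately show ?thesis by (rule that)
qed

section \<open>The group structure and representatives of powers\<close>

lemma equiv_cofinite_eq: "equiv (parcelwise_Ck k) (cofinite_eq k)"
proof (rule equivI)
  show "refl_on (parcelwise_Ck k) (cofinite_eq k)"
    by (auto simp: refl_on_def cofinite_eq_def)
  show "cofinite_eq k \<subseteq> parcelwise_Ck k \<times> parcelwise_Ck k" by (auto simp: cofinite_eq_def)
  show "sym (cofinite_eq k)"
    by (rule symI) (auto simp: cofinite_eq_def eq_commute)
  show "trans (cofinite_eq k)"
    by (rule transI) (auto simp: cofinite_eq_def elim: eventually_elim2)
qed

lemma cofinite_eq_compose:
  assumes "(f, f') \<in> cofinite_eq k" "(g, g') \<in> cofinite_eq k"
  shows "(f \<circ> g, f' \<circ> g') \<in> cofinite_eq k"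
proof -
  have "g \<in> parcelwise_Ck k" "\<forall>\<^sub>F x in cofinite. f x = f' x" "\<forall>\<^sub>F x in cofinite. g x = g' x"
    using assms by (auto simp: cofinite_eq_def)
  from parcelwise_eventually[OF this(1,2)] this(3)
  have "\<forall>\<^sub>F x in cofinite. f (g x) = f' (g' x)"
    by eventually_elim simp
  then show ?thesis
    using assms by (auto simp: cofinite_eq_def parcelwise_compose)
qed

lemma mult_PC:
  assumes "f \<in> parcelwise_Ck k" "g \<in> parcelwise_Ck k"
  shows "cofinite_eq k `` {f} \<otimes>\<^bsub>PC k\<^esub> cofinite_eq k `` {g} = cofinite_eq k `` {f \<circ> g}"
proof -
  have "congruent2 (cofinite_eq k) (cofinite_eq k) (\<lambda>f g. cofinite_eq k `` {f \<circ> g})"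
    by (intro congruent2I' equiv_class_eq[OF equiv_cofinite_eq] cofinite_eq_compose)
  from UN_equiv_class2[OF equiv_cofinite_eq equiv_cofinite_eq this assms]
  show ?thesis by (simp add: PC_def)
qed

lemma class_in_PC: "f \<in> parcelwise_Ck k \<Longrightarrow> cofinite_eq k `` {f} \<in> carrier (PC k)"
  by (simp add: PC_def quotientI)

lemma PC_cases:
  assumes "\<sigma> \<in> carrier (PC k)"
  obtains f where "f \<in> parcelwise_Ck k" "\<sigma> = cofinite_eq k `` {f}"
  using assms by (auto simp: PC_def elim: quotientE)

lemma one_PC: "\<one>\<^bsub>PC k\<^esub> = cofinite_eq k `` {id}"
  by (simp add: PC_def)

lemma group_PC: "group (PC k)"
proof (rule groupI)
  fix \<sigma> \<tau> assume "\<sigma> \<in> carrier (PC k)" "\<tau> \<in> carrier (PC k)"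
  then show "\<sigma> \<otimes>\<^bsub>PC k\<^esub> \<tau> \<in> carrier (PC k)"
    by (elim PC_cases) (simp add: mult_PC class_in_PC parcelwise_compose)
next
  show "\<one>\<^bsub>PC k\<^esub> \<in> carrier (PC k)"
    by (simp add: one_PC class_in_PC parcelwise_id)
next
  fix \<sigma> \<tau> \<rho> assume "\<sigma> \<in> carrier (PC k)" "\<tau> \<in> carrier (PC k)" "\<rho> \<in> carrier (PC k)"
  then show "\<sigma> \<otimes>\<^bsub>PC k\<^esub> \<tau> \<otimes>\<^bsub>PC k\<^esub> \<rho> = \<sigma> \<otimes>\<^bsub>PC k\<^esub> (\<tau> \<otimes>\<^bsub>PC k\<^esub> \<rho>)"
    by (elim PC_cases) (simp add: mult_PC parcelwise_compose o_assoc)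
next
  fix \<sigma> assume "\<sigma> \<in> carrier (PC k)"
  then show "\<one>\<^bsub>PC k\<^esub> \<otimes>\<^bsub>PC k\<^esub> \<sigma> = \<sigma>"
    by (elim PC_cases) (simp add: one_PC mult_PC parcelwise_id)
next
  fix \<sigma> assume "\<sigma> \<in> carrier (PC k)"
  then obtain f where f: "f \<in> parcelwise_Ck k" "\<sigma> = cofinite_eq k `` {f}" by (rule PC_cases)
  from f(1) obtain h where h: "h \<in> parcelwise_Ck k" "\<forall>\<^sub>F x in cofinite. h (f x) = x"
    by (rule parcelwise_inverse)
  then have "(h \<circ> f, id) \<in> cofinite_eq k"
    using f by (simp add: cofinite_eq_def parcelwise_compose parcelwise_id)
  then have "cofinite_eq k `` {h} \<otimes>\<^bsub>PC k\<^esub> \<sigma> = \<one>\<^bsub>PC k\<^esub>"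
    using f h by (simp add: mult_PC one_PC equiv_class_eq[OF equiv_cofinite_eq])
  then show "\<exists>\<tau>\<in>carrier (PC k). \<tau> \<otimes>\<^bsub>PC k\<^esub> \<sigma> = \<one>\<^bsub>PC k\<^esub>"
    using h(1) by (intro bexI[of _ "cofinite_eq k `` {h}"] class_in_PC)
qed

text \<open>Each power gets its own representative, so the composition law holds only off a finite
  set depending on \<open>p\<close> and \<open>n\<close>.\<close>

lemma PC_power_representatives:
  assumes "\<sigma> \<in> carrier (PC k)"
  obtains r :: "int \<Rightarrow> circle \<Rightarrow> circle" where
    "\<And>n. r n \<in> parcelwise_Ck k" "\<And>n. r n \<in> \<sigma> [^]\<^bsub>PC k\<^esub> n"
    "\<And>p n. \<forall>\<^sub>F x in cofinite. r (p + n) x = r p (r n x)"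
    "\<forall>\<^sub>F x in cofinite. r 0 x = x"
proof -
  interpret group "PC k" by (rule group_PC)
  have "\<forall>n::int. \<exists>f. f \<in> parcelwise_Ck k \<and> \<sigma> [^]\<^bsub>PC k\<^esub> n = cofinite_eq k `` {f}"
    using int_pow_closed[OF assms] by (metis PC_cases)
  then obtain r where r: "r n \<in> parcelwise_Ck k" "\<sigma> [^]\<^bsub>PC k\<^esub> n = cofinite_eq k `` {r n}"
    for n :: int by metis
  note eqD = eq_equiv_class[OF _ equiv_cofinite_eq]
  show ?thesis
  proof (rule that[of r])
    show "r n \<in> \<sigma> [^]\<^bsub>PC k\<^esub> n" for n
      using r equiv_class_self[OF equiv_cofinite_eq] by metis
    show "\<forall>\<^sub>F x in cofinite. r (p + n) x = r p (r n x)" for p n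
    proof -
      have "cofinite_eq k `` {r (p + n)} = cofinite_eq k `` {r p \<circ> r n}"
        using int_pow_mult[OF assms, of p n] by (simp add: r mult_PC)
      from eqD[OF this] show ?thesis
        by (simp add: cofinite_eq_def r parcelwise_compose)
    qed
    have "cofinite_eq k `` {r 0} = cofinite_eq k `` {id}"
      using r(2)[of 0] by (simp add: one_PC)
    from eqD[OF this] show "\<forall>\<^sub>F x in cofinite. r 0 x = x"
      by (simp add: cofinite_eq_def parcelwise_id)
  qed (rule r)
qed

section \<open>One-sided germs and regular points\<close>

text \<open>The punctured one-sided neighbourhoods of \<open>x\<close>, on the right for
  \<open>e = 1\<close> and on the left for \<open>e = -1\<close>. As germs are filters, a map acts
  on them by \<open>filtermap\<close>, even where it has no continuous extension.\<close>

definition germ :: "circle \<Rightarrow> real \<Rightarrow> circle filter" where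
  "germ x e = filtermap (\<lambda>s. x + proj (e * s)) (at_right 0)"

lemma germ_nontrivial: "germ x e \<noteq> bot"
  by (simp add: germ_def filtermap_bot_iff)

lemma germ_le_cofinite:
  assumes "e \<in> {1, -1}"
  shows "germ x e \<le> cofinite"
proof (rule filter_leI)
  fix P assume ev: "eventually P (cofinite :: circle filter)"
  have "\<forall>\<^sub>F s in at_right 0. P (x + proj (- s))"
    using eventually_translate[OF ev, of x "{..<0}"] at_left_minus[of 0]
    by (simp add: eventually_filtermap)
  moreover have "\<forall>\<^sub>F s in at_right 0. P (x + proj s)"
    by (rule eventually_translate[OF ev])
  ultimately show "eventually P (germ x e)"
    using assms by (auto simp: germ_def eventually_filtermap)
qed

lemma germ_le_nhds: "germ x e \<le> nhds x"
proof -
  obtain a where x: "x = proj a" using proj_surj by blast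
  have "((\<lambda>s. a + e * s) \<longlongrightarrow> a + e * 0) (at_right 0)"
    by (intro tendsto_intros)
  then have "((\<lambda>s. proj (a + e * s)) \<longlongrightarrow> proj a) (at_right 0)"
    by (intro tendsto_proj) simp
  then show ?thesis by (simp add: germ_def x proj_add filterlim_def)
qed

lemma right_lim_germ: "right_lim f x = Lim (germ x 1) f"
  by (simp add: right_lim_def germ_def Topological_Spaces.Lim_def filterlim_filtermap)

lemma left_lim_germ: "left_lim f x = Lim (germ x (-1)) f"
  by (simp add: left_lim_def germ_def Topological_Spaces.Lim_def filterlim_filtermap at_left_minus[of 0])

lemma right_lim_eq: "(f \<longlongrightarrow> y) (germ x 1) \<Longrightarrow> right_lim f x = y"
  by (simp add: right_lim_germ tendsto_Lim germ_nontrivial)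

lemma left_lim_eq: "(f \<longlongrightarrow> y) (germ x (-1)) \<Longrightarrow> left_lim f x = y"
  by (simp add: left_lim_germ tendsto_Lim germ_nontrivial)

text \<open>The complement of K_0, ..., K_i, see \<open>UN_K_rep\<close>. An arbitrary local
  extension \<open>g\<close> composes and inverts more easily than \<open>right_lim f\<close>, which
  \<open>K_rep\<close> uses.\<close>

definition regular :: "nat \<Rightarrow> (circle \<Rightarrow> circle) \<Rightarrow> circle \<Rightarrow> bool" where
  "regular i f x \<longleftrightarrow>
     (\<exists>U V g. x \<in> U \<and> Ck_diffeo i U V g \<and> (\<forall>\<^sub>F y in cofinite. y \<in> U \<longrightarrow> g y = f y))"

lemma regularI:
  "x \<in> U \<Longrightarrow> Ck_diffeo i U V g \<Longrightarrow> \<forall>\<^sub>F y in cofinite. y \<in> U \<longrightarrow> g y = f y \<Longrightarrow> regular i f x"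
  unfolding regular_def by (intro exI conjI)

text \<open>A germ eventually avoids the finite set where \<open>g\<close> and \<open>f\<close>
  differ, so \<open>f\<close> inherits the limit of \<open>g\<close>. Hence all local extensions
  have the same value at \<open>x\<close>.\<close>

lemma local_extension_tendsto:
  assumes "Ck_diffeo i U V g" "x \<in> U" "\<forall>\<^sub>F y in cofinite. y \<in> U \<longrightarrow> g y = f y" "e \<in> {1, -1}"
  shows "(f \<longlongrightarrow> g x) (germ x e)"
proof -
  have U: "open U" and "continuous_on U g"
    using assms(1) by (auto simp: Ck_diffeo_def intro: Ck_circle_imp_continuous_on)
  then have "(g \<longlongrightarrow> g x) (nhds x)"
    using assms(2) by (simp add: continuous_on_eq_continuous_at isCont_def tendsto_at_iff_tendsto_nhds)
  then have lim: "(g \<longlongrightarrow> g x) (germ x e)"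
    by (rule tendsto_mono[OF germ_le_nhds])
  have "\<forall>\<^sub>F y in germ x e. y \<in> U"
    using eventually_nhds_in_open[OF U assms(2)] filter_leD[OF germ_le_nhds] by blast
  moreover have "\<forall>\<^sub>F y in germ x e. y \<in> U \<longrightarrow> g y = f y"
    using assms(3) filter_leD[OF germ_le_cofinite[OF assms(4)]] by blast
  ultimately have "\<forall>\<^sub>F y in germ x e. g y = f y" by eventually_elim simp
  with lim show ?thesis by (rule Lim_transform_eventually)
qed

lemma right_lim_local_extension:
  "Ck_diffeo i U V g \<Longrightarrow> \<forall>\<^sub>F y in cofinite. y \<in> U \<longrightarrow> g y = f y \<Longrightarrow> x \<in> U \<Longrightarrow> right_lim f x = g x"
  by (rule right_lim_eq) (rule local_extension_tendsto; simp)

lemma regular_tendsto: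
  assumes "regular i f x" "e \<in> {1, -1}"
  shows "(f \<longlongrightarrow> right_lim f x) (germ x e)"
proof -
  obtain U V g where g: "x \<in> U" "Ck_diffeo i U V g" "\<forall>\<^sub>F y in cofinite. y \<in> U \<longrightarrow> g y = f y"
    using assms(1) unfolding regular_def by blast
  have "right_lim f x = g x" by (rule right_lim_local_extension[OF g(2,3,1)])
  then show ?thesis using local_extension_tendsto[OF g(2,1,3) assms(2)] by simp
qed

lemma regular_antimono: "regular k f x \<Longrightarrow> i \<le> k \<Longrightarrow> regular i f x"
  unfolding regular_def by (meson Ck_diffeo_antimono)

lemma parcelwise_cofinitely_regular:
  assumes "f \<in> parcelwise_Ck k" "i \<le> k"
  shows "\<forall>\<^sub>F x in cofinite. regular i f x \<and> right_lim f x = f x"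
proof -
  from assms obtain A B where AB: "finite (- A)" "Ck_diffeo k A B f"
    by (elim parcelwise_CkE)
  then have "regular i f x \<and> right_lim f x = f x" if "x \<in> A" for x
    using that assms(2) Ck_diffeo_antimono right_lim_local_extension[OF AB(2), of f x]
    unfolding regular_def by fastforce
  moreover have "\<forall>\<^sub>F x in cofinite. x \<in> A"
    using AB(1) by (simp add: eventually_cofinite Compl_eq)
  ultimately show ?thesis by (auto elim: eventually_mono)
qed

lemma finite_irregular: "f \<in> parcelwise_Ck k \<Longrightarrow> i \<le> k \<Longrightarrow> finite {x. \<not> regular i f x}"
  using parcelwise_cofinitely_regular[THEN eventually_conj_iff[THEN iffD1, THEN conjunct1]]
  by (simp add: eventually_cofinite)

text \<open>A local extension is forced to coincide with \<open>right_lim f\<close> on its domain,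
  and conversely \<open>right_lim f\<close> differs from \<open>f\<close> at finitely many points
  only.\<close>

lemma regular_iff_right_lim:
  assumes "f \<in> parcelwise_Ck k"
  shows "regular i f x \<longleftrightarrow> (\<exists>U V. x \<in> U \<and> Ck_diffeo i U V (right_lim f))"
proof
  assume "regular i f x"
  then obtain U V g where g: "x \<in> U" "Ck_diffeo i U V g" "\<forall>\<^sub>F y in cofinite. y \<in> U \<longrightarrow> g y = f y"
    unfolding regular_def by blast
  have "Ck_diffeo i U V (right_lim f)"
    using g(2) by (rule Ck_diffeo_cong) (rule right_lim_local_extension[OF g(2,3), symmetric])
  with g(1) show "\<exists>U V. x \<in> U \<and> Ck_diffeo i U V (right_lim f)" by blast
next
  assume "\<exists>U V. x \<in> U \<and> Ck_diffeo i U V (right_lim f)"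
  moreover have "\<forall>\<^sub>F y in cofinite. y \<in> U \<longrightarrow> right_lim f y = f y" for U
    using parcelwise_cofinitely_regular[OF assms order_refl] by eventually_elim simp
  ultimately show "regular i f x" unfolding regular_def by blast
qed

text \<open>The local extensions compose, and the finite set where \<open>g'\<close> differs from
  \<open>h\<close> pulls back along \<open>f\<close> to a finite set. Since \<open>q\<close> is
  prescribed only off a finite set, this applies to the representatives of powers.\<close>

lemma regular_compose:
  assumes f: "f \<in> parcelwise_Ck k"
    and reg: "regular i f x" "regular i h (right_lim f x)"
    and q: "\<forall>\<^sub>F y in cofinite. q y = h (f y)"
  shows "regular i q x \<and> right_lim q x = right_lim h (right_lim f x)"
proof -
  obtain U V g where g: "x \<in> U" "Ck_diffeo i U V g" "\<forall>\<^sub>F y in cofinite. y \<in> U \<longrightarrow> g y = f y"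
    using reg(1) unfolding regular_def by blast
  then have gx: "right_lim f x = g x" by (intro right_lim_local_extension)
  obtain U' V' g' where g': "g x \<in> U'" "Ck_diffeo i U' V' g'"
      "\<forall>\<^sub>F y in cofinite. y \<in> U' \<longrightarrow> g' y = h y"
    using reg(2) unfolding regular_def gx by blast
  then have g'x: "right_lim h (g x) = g' (g x)" by (intro right_lim_local_extension)
  obtain W where W: "Ck_diffeo i (U \<inter> g -` U') W (\<lambda>y. g' (g y))"
    using Ck_diffeo_compose[OF g(2) g'(2)] by blast
  have ev: "\<forall>\<^sub>F y in cofinite. y \<in> U \<inter> g -` U' \<longrightarrow> g' (g y) = q y"
    using g(3) q parcelwise_eventually[OF f g'(3)] by eventually_elim auto
  have x: "x \<in> U \<inter> g -` U'" using g(1) g'(1) by simp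
  have "regular i q x" by (rule regularI[OF x W ev])
  moreover have "right_lim q x = g' (g x)" using right_lim_local_extension[OF W ev x] by simp
  ultimately show ?thesis using gx g'x by simp
qed

lemma regular_id: "\<forall>\<^sub>F y in cofinite. f y = y \<Longrightarrow> regular i f x \<and> right_lim f x = x"
proof -
  assume ev: "\<forall>\<^sub>F y in cofinite. f y = y"
  have D: "Ck_diffeo i UNIV UNIV (\<lambda>x. x)"
    by (rule Ck_diffeoI[where h = "\<lambda>x. x"]) (auto intro: Ck_circle_ident)
  have ev': "\<forall>\<^sub>F y in cofinite. y \<in> UNIV \<longrightarrow> y = f y"
    using ev by eventually_elim simp
  then have "regular i f x" by (intro regularI[OF _ D ev']) simp
  with right_lim_local_extension[OF D ev'] show ?thesis by simp
qed

text \<open>The inverse \<open>q\<close> of the local extension of \<open>f\<close> is a local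
  extension of \<open>h\<close>, because regularity means being a diffeomorphism. The points where
  \<open>q\<close> and \<open>h\<close> differ are images under \<open>g\<close> of finitely many
  exceptional points.\<close>

lemma regular_inverse:
  assumes "regular i f x" "\<forall>\<^sub>F y in cofinite. h (f y) = y"
  shows "regular i h (right_lim f x)"
proof -
  obtain U V g where g: "x \<in> U" "Ck_diffeo i U V g" "\<forall>\<^sub>F y in cofinite. y \<in> U \<longrightarrow> g y = f y"
    using assms(1) unfolding regular_def by blast
  then have gx: "right_lim f x = g x" by (intro right_lim_local_extension)
  from g(2) obtain q where q: "open U" "open V" "Ck_circle i U g" "Ck_circle i V q"
    "\<And>x. x \<in> U \<Longrightarrow> g x \<in> V \<and> q (g x) = x" "\<And>y. y \<in> V \<Longrightarrow> q y \<in> U \<and> g (q y) = y"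
    by (rule Ck_diffeoE) blast
  have D: "Ck_diffeo i V U q" by (rule Ck_diffeoI[OF q(2,1,4,3,6,5)])
  let ?N = "{y. \<not> (y \<in> U \<longrightarrow> g y = f y) \<or> h (f y) \<noteq> y}"
  have "finite ?N"
    using eventually_conj[OF g(3) assms(2)] by (simp add: eventually_cofinite)
  moreover have "{y. \<not> (y \<in> V \<longrightarrow> q y = h y)} \<subseteq> g ` ?N"
  proof
    fix y assume y: "y \<in> {y. \<not> (y \<in> V \<longrightarrow> q y = h y)}"
    then have "q y \<in> U" "g (q y) = y" using q(6) by auto
    moreover from this y have "q y \<in> ?N" by auto
    ultimately show "y \<in> g ` ?N" by force
  qed
  ultimately have "\<forall>\<^sub>F y in cofinite. y \<in> V \<longrightarrow> q y = h y"
    unfolding eventually_cofinite by (meson finite_imageI finite_subset)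
  then show ?thesis using q(5)[OF g(1)] unfolding gx by (intro regularI[OF _ D]) auto
qed

section \<open>The action of a transformation on one-sided germs\<close>

lemma filtermap_cong_eventually:
  "\<forall>\<^sub>F x in F. f x = g x \<Longrightarrow> filtermap f F = filtermap g F"
  unfolding filter_eq_iff eventually_filtermap by (auto elim: eventually_elim2)

text \<open>Monotonicity makes \<open>F\<close> positive, which gives one inequality; by the
  intermediate value theorem \<open>F\<close> attains every small positive number, which gives the
  other.\<close>

lemma filtermap_strict_mono_at_right_0:
  fixes F :: "real \<Rightarrow> real"
  assumes r: "r > 0" and cont: "continuous_on {0<..<r} F"
    and mono: "strict_mono_on {0<..<r} F" and lim: "(F \<longlongrightarrow> 0) (at_right 0)"
  shows "filtermap F (at_right 0) = at_right 0"
proof (rule antisym)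
  \<comment> \<open>The detour through \<open>s / 2\<close> makes the inequality strict.\<close>
  have pos: "F s > 0" if s: "0 < s" "s < r" for s
  proof -
    have "\<forall>\<^sub>F t in at_right 0. F t \<le> F (s / 2)"
      unfolding eventually_at_right_field
    proof (intro exI[of _ "s / 2"] conjI allI impI)
      show "F t \<le> F (s / 2)" if "0 < t" "t < s / 2" for t
        using strict_mono_onD[OF mono, of t "s / 2"] s that by simp
    qed (use s in simp)
    then have "0 \<le> F (s / 2)" using lim by (intro tendsto_upperbound[OF lim]) simp_all
    also have "\<dots> < F s" using s by (intro strict_mono_onD[OF mono]) simp_all
    finally show ?thesis .
  qed
  have "\<forall>\<^sub>F s in at_right 0. F s > 0"
    unfolding eventually_at_right_field using r pos by blast
  with lim show "filtermap F (at_right 0) \<le> at_right 0"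
    unfolding filterlim_def[symmetric] by (rule tendsto_imp_filterlim_at_right)
  show "at_right 0 \<le> filtermap F (at_right 0)"
  proof (rule filter_leI)
    fix P assume "eventually P (filtermap F (at_right 0))"
    then obtain b where b: "b > 0" "\<And>s. 0 < s \<Longrightarrow> s < b \<Longrightarrow> P (F s)"
      by (auto simp: eventually_filtermap eventually_at_right_field)
    define c where "c = min b r / 2"
    have c: "0 < c" "c < b" "c < r" using b(1) r by (auto simp: c_def)
    have "P t" if t: "0 < t" "t < F c" for t
    proof -
      have "\<forall>\<^sub>F s in at_right 0. F s < t" by (rule order_tendstoD(2)[OF lim t(1)])
      then obtain q where q: "q > 0" "\<And>s. 0 < s \<Longrightarrow> s < q \<Longrightarrow> F s < t"
        by (auto simp: eventually_at_right_field)
      define s where "s = min q c / 2"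
      have s: "0 < s" "s < q" "s < c" using q(1) c by (auto simp: s_def)
      have "continuous_on {s..c} F"
        using s c by (intro continuous_on_subset[OF cont]) auto
      then obtain u where "s \<le> u" "u \<le> c" "F u = t"
        using IVT'[of F s t c] q(2)[of s] s t by auto
      then show "P t" using b(2)[of u] s c by auto
    qed
    then show "eventually P (at_right 0)"
      unfolding eventually_at_right_field using pos c by blast
  qed
qed

lemma strict_mono_bounded_below_limit:
  fixes G :: "real \<Rightarrow> real"
  assumes r: "r > 0" and mono: "strict_mono_on {0<..<r} G"
    and bdd: "\<And>s. 0 < s \<Longrightarrow> s < r \<Longrightarrow> m \<le> G s"
  obtains L where "(G \<longlongrightarrow> L) (at_right 0)"
proof
  have bb: "bdd_below (G ` {0<..<r})" using bdd by (intro bdd_belowI[of _ m]) auto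
  show "(G \<longlongrightarrow> Inf (G ` {0<..<r})) (at_right 0)"
  proof (rule order_tendstoI)
    fix a assume a: "a < Inf (G ` {0<..<r})"
    have "a < G s" if "0 < s" "s < r" for s
      using a cInf_lower[OF _ bb, of "G s"] that by fastforce
    then show "\<forall>\<^sub>F s in at_right 0. a < G s"
      unfolding eventually_at_right_field using r by blast
  next
    fix a assume "a > Inf (G ` {0<..<r})"
    then obtain s where s: "0 < s" "s < r" "G s < a"
      using bb r by (subst (asm) cInf_less_iff) auto
    have "G t < a" if "0 < t" "t < s" for t
      using strict_mono_onD[OF mono, of t s] s that by simp
    then show "\<forall>\<^sub>F s in at_right 0. G s < a"
      unfolding eventually_at_right_field using s(1) by blast
  qed
qed

text \<open>On a short one-sided interval \<open>f\<close> has a real lift that is injective modulo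
  the integers. It is therefore strictly monotone and bounded, so it has a one-sided limit, and the
  direction of monotonicity gives the side of the image germ.\<close>

lemma filtermap_germ:
  assumes f: "f \<in> parcelwise_Ck k" and e: "e \<in> {1, -1}"
  obtains y d where "d \<in> {1, -1}" "filtermap f (germ x e) = germ y d"
proof -
  from f obtain A B where AB: "finite (- A)" "Ck_diffeo k A B f" by (elim parcelwise_CkE)
  have cf: "continuous_on A f" and injf: "inj_on f A"
    using AB(2) by (auto simp: Ck_diffeo_def bij_betw_def intro: Ck_circle_imp_continuous_on)
  obtain a where x: "x = proj a" using proj_surj by blast
  have "\<forall>\<^sub>F y in cofinite. y \<in> A" using AB(1) by (simp add: eventually_cofinite Compl_eq)
  then have "eventually (\<lambda>y. y \<in> A) (germ x e)"
    using filter_leD[OF germ_le_cofinite[OF e]] by blast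
  then obtain r0 where r0: "r0 > 0" "\<And>s. 0 < s \<Longrightarrow> s < r0 \<Longrightarrow> x + proj (e * s) \<in> A"
    by (auto simp: germ_def eventually_filtermap eventually_at_right_field)
  \<comment> \<open>At most 1, so that distinct parameters in \<open>I\<close> give distinct points
    of the circle.\<close>
  define r where "r = min r0 1"
  define I where "I = {0<..<r}"
  have r: "r > 0" and rA: "\<And>s. s \<in> I \<Longrightarrow> x + proj (e * s) \<in> A"
    using r0 by (auto simp: r_def I_def)
  define h where "h = (\<lambda>s. f (x + proj (e * s)))"
  have "continuous_on I h"
    unfolding h_def
  proof (rule continuous_on_compose2[OF cf])
    have "continuous_on I (\<lambda>s. proj (a + e * s))"
      by (rule continuous_on_compose2[OF continuous_on_proj[of UNIV]]) (auto intro!: continuous_intros)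
    then show "continuous_on I (\<lambda>s. x + proj (e * s))" by (simp add: x proj_add)
  qed (use rA in auto)
  then obtain F where F: "continuous_on I F" "\<And>s. s \<in> I \<Longrightarrow> h s = proj (F s)"
    using lift_to_real[of I h] by (auto simp: I_def)
  have inj: "s = t" if st: "s \<in> I" "t \<in> I" "F s - F t \<in> \<int>" for s t
  proof -
    have "h s = h t" using F(2) st by (simp add: proj_eq_iff)
    then have "x + proj (e * s) = x + proj (e * t)"
      unfolding h_def by (rule inj_onD[OF injf]) (use rA st in auto)
    then have "e * s - e * t \<in> \<int>" by (simp add: proj_eq_iff)
    then have "s - t \<in> \<int>" using e Ints_minus[of "t - s"] by auto
    moreover have "\<bar>s - t\<bar> < 1" using st by (auto simp: I_def r_def)
    ultimately show "s = t" using Ints_nonzero_abs_less1[of "s - t"] by auto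
  qed
  then have "inj_on F I" by (intro inj_onI) auto
  then have "strict_mono_on I F \<or> strict_antimono_on I F"
    using F(1) by (subst (asm) injective_eq_monotone_map) (auto simp: I_def is_interval_oo)
  then obtain d :: real where d: "d \<in> {1, -1}" and mono: "strict_mono_on I (\<lambda>s. d * F s)"
  proof
    assume "strict_antimono_on I F"
    then have "strict_mono_on I (\<lambda>s. -1 * F s)" by (auto simp: monotone_on_def)
    then show ?thesis using that[of "-1"] by blast
  qed (use that[of 1] in simp)
  define G where "G = (\<lambda>s. d * F s)"
  have dG: "d * G s = F s" for s using d by (auto simp: G_def)
  have contG: "continuous_on I G" unfolding G_def by (intro continuous_intros F)
  have mono': "strict_mono_on {0<..<r} G" using mono by (simp add: G_def I_def)
  \<comment> \<open>If \<open>G\<close> fell more than 1 below \<open>G (r / 2)\<close>, it would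
    take the value \<open>G s + 1\<close> to the right of \<open>s\<close>, and the lift would not
    be injective modulo the integers.\<close>
  have lower: "G (r / 2) - 1 \<le> G s" if s: "0 < s" "s < r" for s
  proof (rule ccontr)
    assume c: "\<not> G (r / 2) - 1 \<le> G s"
    have "s < r / 2"
    proof (rule ccontr)
      assume "\<not> s < r / 2"
      then have "G (r / 2) \<le> G s" using s r by (intro strict_mono_on_leD[OF mono']) auto
      with c show False by simp
    qed
    have "continuous_on {s..r / 2} G"
      using s r by (intro continuous_on_subset[OF contG]) (auto simp: I_def)
    then obtain u where u: "s \<le> u" "u \<le> r / 2" "G u = G s + 1"
      using IVT'[of G s "G s + 1" "r / 2"] c \<open>s < r / 2\<close> by auto
    have "F u - F s = d" using u(3) by (simp flip: dG add: algebra_simps)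
    then have "F u - F s \<in> \<int>" using d by auto
    then have "u = s" using u s r by (intro inj) (auto simp: I_def)
    with u(3) show False by simp
  qed
  obtain L where L: "(G \<longlongrightarrow> L) (at_right 0)"
    using strict_mono_bounded_below_limit[OF r mono' lower] by blast
  have "((\<lambda>s. G s - L) \<longlongrightarrow> 0) (at_right 0)" using L by (simp add: LIM_zero_iff)
  moreover have "continuous_on {0<..<r} (\<lambda>s. G s - L)"
    using contG by (auto simp: I_def intro!: continuous_intros)
  moreover have "strict_mono_on {0<..<r} (\<lambda>s. G s - L)" using mono' by (auto simp: monotone_on_def)
  ultimately have G0: "filtermap (\<lambda>s. G s - L) (at_right 0) = at_right 0"
    by (intro filtermap_strict_mono_at_right_0[OF r])
  have "\<forall>\<^sub>F s in at_right 0. f (x + proj (e * s)) = proj (d * L) + proj (d * (G s - L))"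
    unfolding eventually_at_right_field
  proof (intro exI[of _ r] conjI allI impI r)
    fix s assume "0 < s" "s < r"
    then have "f (x + proj (e * s)) = proj (F s)" using F(2)[of s] by (simp add: h_def I_def)
    then show "f (x + proj (e * s)) = proj (d * L) + proj (d * (G s - L))"
      by (simp flip: proj_add dG add: algebra_simps)
  qed
  then have "filtermap f (germ x e) = filtermap (\<lambda>s. proj (d * L) + proj (d * (G s - L))) (at_right 0)"
    unfolding germ_def filtermap_filtermap by (rule filtermap_cong_eventually)
  also have "\<dots> = filtermap (\<lambda>t. proj (d * L) + proj (d * t)) (filtermap (\<lambda>s. G s - L) (at_right 0))"
    by (simp add: filtermap_filtermap)
  also have "\<dots> = germ (proj (d * L)) d" by (simp only: G0 germ_def)
  finally show ?thesis using d that by blast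
qed

lemma tendsto_germ_unique:
  assumes "(f \<longlongrightarrow> z) (germ x e)" "filtermap f (germ x e) \<le> germ y d"
  shows "y = z"
proof -
  have "(f \<longlongrightarrow> y) (germ x e)"
    unfolding filterlim_def using assms(2) germ_le_nhds by (rule order_trans)
  then show ?thesis using assms(1) germ_nontrivial tendsto_unique by blast
qed

text \<open>The limit recovers the base point. The two sides of \<open>x\<close> differ because
  \<open>x - t\<close> and \<open>x + s\<close> with \<open>s\<close> and \<open>t\<close> in (0,
  1/2) are distinct on the circle: \<open>s + t\<close> lies strictly between 0 and 1.\<close>

lemma germ_inject:
  assumes eq: "germ x e = germ y d" and ed: "e \<in> {1, -1}" "d \<in> {1, -1}"
  shows "x = y \<and> e = d"
proof -
  have "((\<lambda>z. z) \<longlongrightarrow> y) (germ x e)"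
    unfolding filterlim_def eq by (simp add: germ_le_nhds filtermap_ident)
  then have xy: "x = y" by (rule tendsto_germ_unique[of _ _ x e x e]) (simp add: filtermap_ident)
  have "e = d"
  proof (rule ccontr)
    assume "e \<noteq> d"
    then have d: "d = - e" using ed by auto
    have "\<forall>\<^sub>F s in at_right 0. s < (1/2::real) \<and> 0 < s"
      unfolding eventually_at_right_field by (intro exI[of _ "1/2"]) simp
    then have "\<forall>\<^sub>F z in germ x e. \<exists>s. 0 < s \<and> s < 1/2 \<and> z = x + proj (e * s)"
      unfolding germ_def eventually_filtermap by eventually_elim blast
    then have "\<forall>\<^sub>F t in at_right 0. \<exists>s. 0 < s \<and> s < 1/2 \<and> x + proj (- e * t) = x + proj (e * s)"
      unfolding eq unfolding germ_def eventually_filtermap by (simp add: d xy)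
    then obtain b where b: "b > 0"
      "\<And>t. 0 < t \<Longrightarrow> t < b \<Longrightarrow> \<exists>s. 0 < s \<and> s < 1/2 \<and> x + proj (- e * t) = x + proj (e * s)"
      unfolding eventually_at_right_field by blast
    define t where "t = min b (1/2) / 2"
    have t: "0 < t" "t < b" "t < 1/2" using b(1) by (auto simp: t_def)
    obtain s where s: "0 < s" "s < 1/2" "x + proj (- e * t) = x + proj (e * s)"
      using b(2)[OF t(1,2)] by blast
    then have "- e * t - e * s \<in> \<int>" by (simp add: proj_eq_iff)
    then have "s + t \<in> \<int>" using ed Ints_minus[of "- t - s"] by (auto simp: algebra_simps)
    then show False using Ints_nonzero_abs_less1[of "s + t"] s t by auto
  qed
  with xy show ?thesis by simp
qed

lemma filtermap_germ_inverse:
  assumes "\<forall>\<^sub>F z in cofinite. h (f z) = z" "e \<in> {1, -1}"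
  shows "filtermap h (filtermap f (germ x e)) = germ x e"
proof -
  have "\<forall>\<^sub>F z in germ x e. h (f z) = z"
    by (rule filter_leD[OF germ_le_cofinite[OF assms(2)] assms(1)])
  from filtermap_cong_eventually[OF this] show ?thesis
    by (simp add: filtermap_filtermap filtermap_ident)
qed

lemma filtermap_germ_inject:
  assumes f: "f \<in> parcelwise_Ck k" and ed: "e \<in> {1, -1}" "d \<in> {1, -1}"
    and eq: "filtermap f (germ x e) = filtermap f (germ y d)"
  shows "x = y \<and> e = d"
proof -
  from f obtain h where "\<forall>\<^sub>F z in cofinite. h (f z) = z" by (rule parcelwise_inverse)
  then have "germ x e = germ y d"
    using filtermap_germ_inverse[of h f] ed eq by metis
  then show ?thesis using ed by (rule germ_inject)
qed

text \<open>If the image under \<open>f\<close> of a germ at \<open>x\<close> had a base point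
  regular for \<open>h\<close>, then \<open>h\<close> would send that point to \<open>x\<close>, and
  inverting would make \<open>f\<close> regular at \<open>x\<close>. So germs at irregular points of
  \<open>f\<close> inject into germs at irregular points of \<open>h\<close>; with two germs per
  point, the factor 2 cancels.\<close>

lemma card_irregular_le:
  assumes f: "f \<in> parcelwise_Ck k" and h: "h \<in> parcelwise_Ck k" and i: "i \<le> k"
    and hf: "\<forall>\<^sub>F z in cofinite. h (f z) = z" and fh: "\<forall>\<^sub>F z in cofinite. f (h z) = z"
  shows "card {x. \<not> regular i f x} \<le> card {x. \<not> regular i h x}"
proof -
  let ?E = "{1, -1 :: real}"
  have "\<forall>p. \<exists>q. snd p \<in> ?E \<longrightarrow> snd q \<in> ?E \<and>
      filtermap f (germ (fst p) (snd p)) = germ (fst q) (snd q)"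
  proof
    fix p :: "circle \<times> real"
    show "\<exists>q. snd p \<in> ?E \<longrightarrow> snd q \<in> ?E \<and>
      filtermap f (germ (fst p) (snd p)) = germ (fst q) (snd q)"
    proof (cases "snd p \<in> ?E")
      case True
      then obtain d y where "d \<in> ?E" "filtermap f (germ (fst p) (snd p)) = germ y d"
        by (rule filtermap_germ[OF f])
      then show ?thesis by (intro exI[of _ "(y, d)"]) auto
    qed blast
  qed
  then obtain \<psi> where \<psi>: "snd p \<in> ?E \<Longrightarrow> snd (\<psi> p) \<in> ?E \<and>
      filtermap f (germ (fst p) (snd p)) = germ (fst (\<psi> p)) (snd (\<psi> p))" for p
    by metis
  let ?Zf = "{x. \<not> regular i f x}" and ?Zh = "{x. \<not> regular i h x}"
  have "inj_on \<psi> (?Zf \<times> ?E)"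
  proof (rule inj_onI)
    fix p q assume pq: "p \<in> ?Zf \<times> ?E" "q \<in> ?Zf \<times> ?E" "\<psi> p = \<psi> q"
    then have E: "snd p \<in> ?E" "snd q \<in> ?E" by (simp_all add: mem_Times_iff)
    then have "filtermap f (germ (fst p) (snd p)) = filtermap f (germ (fst q) (snd q))"
      using \<psi>[of p] \<psi>[of q] pq(3) by simp
    from filtermap_germ_inject[OF f E this] show "p = q" by (simp add: prod_eq_iff)
  qed
  moreover have "\<psi> ` (?Zf \<times> ?E) \<subseteq> ?Zh \<times> ?E"
  proof
    fix q assume "q \<in> \<psi> ` (?Zf \<times> ?E)"
    then obtain p where "p \<in> ?Zf \<times> ?E" and qp: "q = \<psi> p" by blast
    then have p: "\<not> regular i f (fst p)" "snd p \<in> ?E" by (simp_all add: mem_Times_iff)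
    then have q: "snd q \<in> ?E" "filtermap f (germ (fst p) (snd p)) = germ (fst q) (snd q)"
      using \<psi>[of p] qp by simp_all
    have "\<not> regular i h (fst q)"
    proof
      assume reg: "regular i h (fst q)"
      have "filtermap h (germ (fst q) (snd q)) = germ (fst p) (snd p)"
        using filtermap_germ_inverse[of h f, OF hf p(2)] q(2) by metis
      then have "fst p = right_lim h (fst q)"
        by (rule tendsto_germ_unique[OF regular_tendsto[OF reg q(1)] eq_refl])
      with regular_inverse[OF reg fh] p(1) show False by simp
    qed
    with q(1) show "q \<in> ?Zh \<times> ?E" by (simp add: mem_Times_iff)
  qed
  moreover have "finite (?Zh \<times> ?E)" using finite_irregular[OF h i] by simp
  ultimately have "card (?Zf \<times> ?E) \<le> card (?Zh \<times> ?E)" by (rule card_inj_on_le)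
  then show ?thesis by (simp add: card_cartesian_product)
qed

section \<open>Regular points and the sets K_i\<close>

lemma at_le_sup_germ: "at x \<le> sup (germ x 1) (germ x (-1))"
proof (rule filter_leI)
  fix P assume "eventually P (sup (germ x 1) (germ x (-1)))"
  then have "\<forall>\<^sub>F s in at_right 0. P (x + proj s)" "\<forall>\<^sub>F s in at_left 0. P (x + proj s)"
    by (simp_all add: eventually_sup germ_def eventually_filtermap at_left_minus[of 0])
  then have "\<forall>\<^sub>F s in at 0. P (x + proj s)" by (simp add: eventually_at_split)
  then obtain S where S: "open S" "0 \<in> S" "\<And>s. s \<in> S \<Longrightarrow> s \<noteq> 0 \<Longrightarrow> P (x + proj s)"
    by (auto simp: eventually_at_topological)
  obtain a where x: "x = proj a" using proj_surj by blast
  show "eventually P (at x)"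
    unfolding eventually_at_topological
  proof (intro exI[of _ "proj ` (+) a ` S"] conjI ballI impI)
    show "open (proj ` (+) a ` S)" by (intro open_image_proj open_translation S)
    show "x \<in> proj ` (+) a ` S" using S(2) x by force
    fix z assume "z \<in> proj ` (+) a ` S" "z \<noteq> x"
    then obtain s where s: "s \<in> S" "z = x + proj s" by (auto simp: x proj_add)
    with \<open>z \<noteq> x\<close> have "s \<noteq> 0" by (auto simp: proj_0)
    with s show "P z" using S(3) by simp
  qed
qed

text \<open>Equal one-sided limits extend \<open>f\<close> continuously to \<open>x\<close>. The
  real issue is that the extension stays injective; then invariance of domain makes it a local
  homeomorphism.\<close>

lemma regular_0_iff:
  assumes f: "f \<in> parcelwise_Ck k"
  shows "regular 0 f x \<longleftrightarrow> right_lim f x = left_lim f x"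
proof
  assume "regular 0 f x"
  from left_lim_eq[OF regular_tendsto[OF this]] show "right_lim f x = left_lim f x" by simp
next
  assume eq: "right_lim f x = left_lim f x"
  from f obtain A B where AB: "finite (- A)" "Ck_diffeo k A B f" by (elim parcelwise_CkE)
  then have AB0: "Ck_diffeo 0 A B f" by (auto intro: Ck_diffeo_antimono)
  have A: "open A" "continuous_on A f" "inj_on f A"
    using AB(2) by (auto simp: Ck_diffeo_def bij_betw_def intro: Ck_circle_imp_continuous_on)
  show "regular 0 f x"
  proof (cases "x \<in> A")
    case True
    then show ?thesis using AB0 by (rule regularI) simp
  next
    case False
    obtain d1 y1 where 1: "d1 \<in> {1, -1}" "filtermap f (germ x 1) = germ y1 d1"
      by (rule filtermap_germ[OF f, where e = 1 and x = x]) auto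
    obtain d2 y2 where 2: "d2 \<in> {1, -1}" "filtermap f (germ x (-1)) = germ y2 d2"
      by (rule filtermap_germ[OF f, where e = "-1" and x = x]) auto
    have lim1: "(f \<longlongrightarrow> y1) (germ x 1)" and lim2: "(f \<longlongrightarrow> y2) (germ x (-1))"
      by (simp_all add: filterlim_def 1 2 germ_le_nhds)
    then have y: "y1 = y2" using eq by (simp add: right_lim_eq left_lim_eq)
    have d12: "d1 \<noteq> d2"
      using filtermap_germ_inject[OF f, of 1 "-1" x x] 1(2) 2(2) y by auto
    define g where "g = f(x := y1)"
    have "open (insert x A)"
    proof -
      have "closed (- insert x A)" by (intro finite_imp_closed finite_subset[OF _ AB(1)]) auto
      then show ?thesis by (simp only: open_closed)
    qed
    moreover have "continuous_on (insert x A) g"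
    proof (rule continuous_at_imp_continuous_on, rule ballI)
      fix z assume "z \<in> insert x A"
      then consider "z = x" | "z \<in> A" by blast
      then show "isCont g z"
      proof cases
        case 1
        have "(f \<longlongrightarrow> y1) (at x)"
          using filterlim_sup[OF lim1] lim2 y at_le_sup_germ tendsto_mono by blast
        then have "(g \<longlongrightarrow> y1) (at x)"
          by (rule Lim_transform_eventually) (simp add: g_def eventually_at_filter)
        then show ?thesis by (simp add: isCont_def 1 g_def)
      next
        case 2
        have "isCont f z" using A 2 by (simp add: continuous_on_eq_continuous_at)
        moreover have "\<forall>\<^sub>F w in nhds z. g w = f w"
          using eventually_nhds_in_open[OF A(1) 2]
          by eventually_elim (use False in \<open>auto simp: g_def\<close>)
        ultimately show ?thesis by (simp add: isCont_cong)
      qed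
    qed
    \<comment> \<open>The images of the two germs at \<open>x\<close> are distinct and based at
      \<open>y1\<close>, so they are both germs at \<open>y1\<close>. A germ at another point cannot
      be sent to either of them.\<close>
    moreover have nx: "f z \<noteq> y1" if z: "z \<in> A" for z
    proof
      assume fz: "f z = y1"
      have lim: "(f \<longlongrightarrow> y1) (germ z 1)"
        using local_extension_tendsto[OF AB0 z, of f 1] fz by simp
      obtain d y' where d: "d \<in> {1, -1}" "filtermap f (germ z 1) = germ y' d"
        by (rule filtermap_germ[OF f, where e = 1 and x = z]) auto
      have "y' = y1" by (rule tendsto_germ_unique[OF lim eq_refl[OF d(2)]])
      then have "filtermap f (germ z 1) = filtermap f (germ x 1) \<or>
          filtermap f (germ z 1) = filtermap f (germ x (-1))"
        using d 1 2 d12 y by auto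
      then have "z = x" using filtermap_germ_inject[OF f] by blast
      with z False show False by simp
    qed
    then have "inj_on g (insert x A)"
      using A(3) False by (auto simp: g_def inj_on_def)
    ultimately have "Ck_diffeo 0 (insert x A) (g ` insert x A) g"
      by (intro continuous_inj_imp_C0_diffeo)
    moreover have "\<forall>\<^sub>F z in cofinite. z \<in> insert x A \<longrightarrow> g z = f z"
      using finite_subset[of _ "{x}"] by (auto simp: g_def eventually_cofinite)
    ultimately show ?thesis by (rule regularI[OF insertI1])
  qed
qed

text \<open>K_(i+1) consists of the points irregular at level i+1 that lie in no earlier set, and
  irregularity grows with the level, so the union telescopes.\<close>

lemma UN_K_rep:
  assumes f: "f \<in> parcelwise_Ck k"
  shows "(\<Union>j\<le>i. K_rep f j) = {x. \<not> regular i f x}"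
proof (induction i)
  case 0
  then show ?case by (simp add: regular_0_iff[OF f])
next
  case (Suc i)
  have "K_rep f (Suc i) = {x. x \<notin> (\<Union>j\<le>i. K_rep f j) \<and> \<not> regular (Suc i) f x}"
    by (auto simp: regular_iff_right_lim[OF f])
  then show ?case
    unfolding atMost_Suc UN_insert Suc.IH using regular_antimono[of "Suc i" f _ i] by auto
qed

lemma K_rep_disjoint: "j < l \<Longrightarrow> K_rep f j \<inter> K_rep f l = {}"
  by (cases l) auto

lemma sum_card_K_rep:
  assumes f: "f \<in> parcelwise_Ck k" and i: "i \<le> k"
  shows "(\<Sum>j\<le>i. card (K_rep f j)) = card {x. \<not> regular i f x}"
proof -
  have "finite (\<Union>j\<le>i. K_rep f j)"
    unfolding UN_K_rep[OF f] by (rule finite_irregular[OF f i])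
  then have "card (\<Union>j\<in>{..i}. K_rep f j) = (\<Sum>j\<le>i. card (K_rep f j))"
  proof (intro card_UN_disjoint ballI impI)
    fix j l :: nat assume "j \<noteq> l"
    then show "K_rep f j \<inter> K_rep f l = {}"
      using K_rep_disjoint[of j l f] K_rep_disjoint[of l j f] by (cases "j < l") auto
  qed (auto intro: finite_subset)
  then show ?thesis by (simp add: UN_K_rep[OF f])
qed

section \<open>Partial actions of the integers\<close>

text \<open>Beyond some \<open>N\<close> nothing enters \<open>Q\<close> any more: a number missing
  from \<open>Q\<close> excludes all later ones. So \<open>Q\<close> is bounded, with slope 0, or
  contains every number from \<open>N\<close> on, with slope 1.\<close>

lemma eventually_constant_counting:
  fixes Q :: "nat set"
  assumes fin: "finite {j. Suc j \<in> Q \<and> j \<notin> Q}"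
  shows "\<exists>(m::nat) B. \<forall>n. \<bar>int (card {j\<in>Q. j < n}) - int m * int n\<bar> \<le> int B"
proof -
  obtain N where N: "Suc j \<in> Q \<longrightarrow> j \<in> Q" if "j \<ge> N" for j
  proof -
    obtain N where "\<forall>j\<in>{j. Suc j \<in> Q \<and> j \<notin> Q}. j < N"
      using fin finite_nat_set_iff_bounded by auto
    then show ?thesis by (intro that[of N]) (use not_less in blast)
  qed
  show ?thesis
  proof (cases "\<exists>M\<ge>N. M \<notin> Q")
    case True
    then obtain M where M: "M \<ge> N" "M \<notin> Q" by blast
    have "j \<notin> Q" if "j \<ge> M" for j
      using that
    proof (induction j rule: dec_induct)
      case base
      show ?case by (rule M(2))
    next
      case (step j)
      then show ?case using N[of j] M(1) by simp
    qed
    then have "{j\<in>Q. j < n} \<subseteq> {..<M}" for n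
      using not_less by blast
    then have "card {j\<in>Q. j < n} \<le> M" for n
      using card_mono[of "{..<M}"] by fastforce
    then show ?thesis by (intro exI[of _ 0] exI[of _ M]) auto
  next
    case False
    then have Q: "j \<in> Q" if "j \<ge> N" for j using that by blast
    have "int (card {j\<in>Q. j < n}) \<le> int n" "int n \<le> int (card {j\<in>Q. j < n}) + int N" for n
    proof -
      have "card {j\<in>Q. j < n} \<le> card {..<n}" by (rule card_mono) auto
      then show "int (card {j\<in>Q. j < n}) \<le> int n" by simp
      have "{..<n} \<subseteq> {j\<in>Q. j < n} \<union> {..<N}"
        using Q not_less by blast
      then have "card {..<n} \<le> card ({j\<in>Q. j < n} \<union> {..<N})" by (intro card_mono) auto
      also have "\<dots> \<le> card {j\<in>Q. j < n} + card {..<N}" by (rule card_Un_le)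
      finally show "int n \<le> int (card {j\<in>Q. j < n}) + int N" by simp
    qed
    then show ?thesis by (intro exI[of _ 1] exI[of _ N]) (auto simp: abs_le_iff algebra_simps)
  qed
qed

text \<open>To be read as: the power \<open>n\<close> is regular at \<open>x\<close> and takes the
  value \<open>\<phi> n x\<close>. By cancellation \<open>reg (p + n) x\<close> may hold without
  \<open>reg n x\<close>, so \<open>reg_add\<close> is only an implication.\<close>

locale partial_int_action =
  fixes reg :: "int \<Rightarrow> 'x \<Rightarrow> bool" and \<phi> :: "int \<Rightarrow> 'x \<Rightarrow> 'x"
  assumes reg_0: "reg 0 x" and act_0: "\<phi> 0 x = x"
    and reg_add: "reg n x \<Longrightarrow> reg p (\<phi> n x) \<Longrightarrow> reg (p + n) x"
    and act_add: "reg n x \<Longrightarrow> reg p (\<phi> n x) \<Longrightarrow> \<phi> (p + n) x = \<phi> p (\<phi> n x)"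
    and reg_minus: "reg n x \<Longrightarrow> reg (- n) (\<phi> n x)"
    and finite_singular: "finite {x. \<not> reg n x}"
begin

lemma act_minus: "reg n x \<Longrightarrow> \<phi> (- n) (\<phi> n x) = x"
  using act_add[of n x "-n"] reg_minus[of n x] by (simp add: act_0)

lemma act_inj: "reg n x \<Longrightarrow> reg n y \<Longrightarrow> \<phi> n x = \<phi> n y \<Longrightarrow> x = y"
  by (metis act_minus)

text \<open>Go back by \<open>n\<close>, then forward by \<open>p\<close>. Thus the times at which
  an orbit is defined are merely translated when the base point moves along it.\<close>

lemma reg_diff:
  assumes "reg n x" "reg p x" shows "reg (p - n) (\<phi> n x)"
proof -
  have "reg (p + (- n)) (\<phi> n x)"
    using assms by (intro reg_add) (auto simp: act_minus reg_minus)
  then show ?thesis by simp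
qed

definition sing_count :: "int \<Rightarrow> nat" where
  "sing_count n = card {x. \<not> reg n x}"

text \<open>A singular point of the power \<open>p + n\<close> is singular for \<open>n\<close> or
  is moved by \<open>n\<close> to a singular point of \<open>p\<close>, and \<open>\<phi> n\<close>
  is injective on its regular points.\<close>

lemma sing_count_add: "sing_count (p + n) \<le> sing_count p + sing_count n"
proof -
  let ?A = "{x. reg n x \<and> \<not> reg p (\<phi> n x)}"
  have inj: "inj_on (\<phi> n) ?A" by (auto intro!: inj_onI dest: act_inj)
  have sub: "\<phi> n ` ?A \<subseteq> {x. \<not> reg p x}" by auto
  have finA: "finite ?A"
    using inj sub finite_singular[of p] by (meson finite_imageD finite_subset)
  have "card ?A \<le> sing_count p"
    unfolding sing_count_def using inj sub finite_singular by (rule card_inj_on_le)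
  moreover have "sing_count (p + n) \<le> card (?A \<union> {x. \<not> reg n x})"
    unfolding sing_count_def using finA finite_singular
    by (intro card_mono) (auto dest: reg_add)
  moreover have "card (?A \<union> {x. \<not> reg n x}) \<le> card ?A + sing_count n"
    unfolding sing_count_def by (rule card_Un_le)
  ultimately show ?thesis by linarith
qed

lemma sing_count_0: "sing_count 0 = 0"
  by (simp add: sing_count_def reg_0)

lemma sing_count_mult: "sing_count (int j * n) \<le> j * sing_count n"
proof (induction j)
  case 0
  then show ?case by (simp add: sing_count_0)
next
  case (Suc j)
  then show ?case
    using sing_count_add[of n "int j * n"] by (simp add: algebra_simps)
qed

text \<open>The times \<open>j\<close> for which \<open>x = \<phi> (- int j) d\<close> is at
  \<open>d\<close> at time \<open>j\<close> and has no defined position after that up to time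
  \<open>n\<close>. Here \<open>s\<close> is time counted from \<open>d\<close>.\<close>

definition exits :: "'x \<Rightarrow> nat \<Rightarrow> nat set" where
  "exits d n = {j. j < n \<and> reg (- int j) d \<and> (\<forall>s>0. s \<le> int n - int j \<longrightarrow> \<not> reg s d)}"

lemma last_exit:
  assumes "\<not> reg (int n) x"
  obtains j where "j < n" "reg (int j) x" "\<And>i. int j < i \<Longrightarrow> i \<le> int n \<Longrightarrow> \<not> reg i x"
proof -
  let ?J = "{j. j < n \<and> reg (int j) x}"
  have n: "0 < n" using assms reg_0 by (cases n) auto
  then have ne: "?J \<noteq> {}" using reg_0 by force
  have fin: "finite ?J" by simp
  show ?thesis
  proof (rule that[of "Max ?J"])
    show "Max ?J < n" "reg (int (Max ?J)) x" using Max_in[OF fin ne] by auto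
    fix i assume i: "int (Max ?J) < i" "i \<le> int n"
    show "\<not> reg i x"
    proof
      assume r: "reg i x"
      then have "i \<noteq> int n" using assms by auto
      then have "nat i \<in> ?J" using i r by auto
      then have "nat i \<le> Max ?J" using fin by simp
      with i show False by linarith
    qed
  qed
qed

lemma singular_eq_exits:
  "{x. \<not> reg (int n) x} = (\<Union>d\<in>{d. \<not> reg 1 d}. (\<lambda>j. \<phi> (- int j) d) ` exits d n)"
proof (intro equalityI subsetI)
  fix x assume "x \<in> {x. \<not> reg (int n) x}"
  then obtain j where j: "j < n" "reg (int j) x" "\<And>i. int j < i \<Longrightarrow> i \<le> int n \<Longrightarrow> \<not> reg i x"
    using last_exit by blast
  define d where "d = \<phi> (int j) x"
  \<comment> \<open>A position of \<open>d\<close> at time \<open>s\<close> would be a position of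
    \<open>x\<close> at time \<open>s + j\<close>, after its last one.\<close>
  have nr: "\<not> reg s d" if "s > 0" "s \<le> int n - int j" for s
    using reg_add[OF j(2), of s] j(3)[of "s + int j"] that by (auto simp: d_def)
  have "\<not> reg 1 d" using nr j(1) by auto
  moreover have "j \<in> exits d n" using j nr by (auto simp: exits_def d_def reg_minus)
  moreover have "x = \<phi> (- int j) d" using j by (simp add: d_def act_minus)
  ultimately show "x \<in> (\<Union>d\<in>{d. \<not> reg 1 d}. (\<lambda>j. \<phi> (- int j) d) ` exits d n)" by blast
next
  fix x assume "x \<in> (\<Union>d\<in>{d. \<not> reg 1 d}. (\<lambda>j. \<phi> (- int j) d) ` exits d n)"
  then obtain d j where x: "x = \<phi> (- int j) d" and j: "j \<in> exits d n" by auto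
  have r: "reg (- int j) d" and e: "\<And>s. s > 0 \<Longrightarrow> s \<le> int n - int j \<Longrightarrow> \<not> reg s d" and l: "j < n"
    using j by (auto simp: exits_def)
  have "reg (int j) x" "\<phi> (int j) x = d" using reg_minus[OF r] act_minus[OF r] x by auto
  then show "x \<in> {x. \<not> reg (int n) x}"
    using reg_diff[of "int j" x "int n"] e[of "int n - int j"] l by auto
qed

text \<open>The common point determines \<open>j\<close> as the last time before \<open>n\<close> at
  which its orbit is defined, and then \<open>d\<close> as its position at that time.\<close>

lemma exits_unique:
  assumes "j \<in> exits d n" "j' \<in> exits d' n" "\<phi> (- int j) d = \<phi> (- int j') d'"
  shows "j = j' \<and> d = d'"
proof -
  have False if j: "j \<in> exits d n" and j': "j' \<in> exits d' n"
    and eq: "\<phi> (- int j) d = \<phi> (- int j') d'" and "j < j'" for j j' d d'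
  proof -
    let ?x = "\<phi> (- int j) d"
    have "reg (int j) ?x" "\<phi> (int j) ?x = d"
      using j reg_minus[of "- int j" d] act_minus[of "- int j" d] by (auto simp: exits_def)
    moreover have "reg (int j') ?x"
      using j' reg_minus[of "- int j'" d'] by (auto simp: exits_def eq)
    ultimately have "reg (int j' - int j) d" using reg_diff by metis
    moreover have "int j' - int j \<le> int n - int j" "0 < int j' - int j"
      using j' \<open>j < j'\<close> by (auto simp: exits_def)
    ultimately show False using j by (auto simp: exits_def)
  qed
  then have "j = j'" using assms by (metis linorder_neqE_nat)
  with assms show ?thesis
    by (auto simp: exits_def dest: act_inj)
qed

text \<open>If \<open>d\<close> is defined again after time \<open>r\<close>, every exit lies in the
  last \<open>r\<close> times before \<open>n\<close>. Otherwise the forward condition is vacuous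
  and \<open>exits d n\<close> counts the times up to \<open>n\<close> at which the backward orbit
  is defined.\<close>

lemma card_exits_linear:
  "\<exists>(m::nat) B. \<forall>n. \<bar>int (card (exits d n)) - int m * int n\<bar> \<le> int B"
proof (cases "\<exists>r>0. reg r d")
  case True
  then obtain r :: nat where r: "r > 0" "reg (int r) d" by (metis pos_int_cases of_nat_0_less_iff)
  have "card (exits d n) \<le> r" for n
  proof -
    have "exits d n \<subseteq> {n - r..<n}"
    proof
      fix j assume j: "j \<in> exits d n"
      then have "\<not> int r \<le> int n - int j" using r by (auto simp: exits_def)
      with j show "j \<in> {n - r..<n}" by (auto simp: exits_def)
    qed
    then have "card (exits d n) \<le> card {n - r..<n}" by (intro card_mono) auto
    also have "\<dots> \<le> r" by simp
    finally show ?thesis .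
  qed
  then show ?thesis by (intro exI[of _ 0] exI[of _ r]) simp
next
  case False
  define Q where "Q = {j. reg (- int j) d}"
  have ex: "exits d n = {j\<in>Q. j < n}" for n using False by (auto simp: exits_def Q_def)
  have inj: "inj_on (\<lambda>j. \<phi> (- int j) d) Q"
  proof (rule inj_onI)
    fix j j' assume "j \<in> Q" "j' \<in> Q" "\<phi> (- int j) d = \<phi> (- int j') d"
    then show "j = j'"
      using exits_unique[of j d "Suc (max j j')" j' d] by (auto simp: ex)
  qed
  have "finite {j. Suc j \<in> Q \<and> j \<notin> Q}"
  proof -
    let ?T = "{j. Suc j \<in> Q \<and> j \<notin> Q}"
    \<comment> \<open>If the first power were regular at this point, one step forward would make the
      backward orbit defined at time \<open>j\<close>.\<close>
    have "\<not> reg 1 (\<phi> (- int (Suc j)) d)" if "Suc j \<in> Q" "j \<notin> Q" for j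
      using reg_add[of "- int (Suc j)" d 1] that by (auto simp: Q_def)
    then have "(\<lambda>j. \<phi> (- int j) d) ` Suc ` ?T \<subseteq> {x. \<not> reg 1 x}" by auto
    then have "finite ((\<lambda>j. \<phi> (- int j) d) ` Suc ` ?T)"
      using finite_singular finite_subset by blast
    moreover have "inj_on (\<lambda>j. \<phi> (- int j) d) (Suc ` ?T)"
      by (rule inj_on_subset[OF inj]) auto
    ultimately have "finite (Suc ` ?T)" by (rule finite_imageD)
    then show ?thesis by (rule finite_imageD) auto
  qed
  then show ?thesis using eventually_constant_counting by (simp add: ex)
qed

lemma sing_count_almost_linear:
  "\<exists>(m::nat) B. \<forall>n. \<bar>int (sing_count (int n)) - int m * int n\<bar> \<le> int B"
proof -
  let ?D = "{d. \<not> reg 1 d}"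
  obtain m B where mB: "\<bar>int (card (exits d n)) - int (m d) * int n\<bar> \<le> int (B d)" for d n
    using card_exits_linear by metis
  \<comment> \<open>\<open>exits_unique\<close> provides both the disjointness over \<open>d\<close>
    and the injectivity in \<open>j\<close>.\<close>
  have cnt: "sing_count (int n) = (\<Sum>d\<in>?D. card (exits d n))" for n
  proof -
    have "sing_count (int n) = (\<Sum>d\<in>?D. card ((\<lambda>j. \<phi> (- int j) d) ` exits d n))"
      unfolding sing_count_def singular_eq_exits
    proof (rule card_UN_disjoint)
      show "\<forall>d\<in>?D. finite ((\<lambda>j. \<phi> (- int j) d) ` exits d n)" by (auto simp: exits_def)
    qed (use finite_singular exits_unique in blast)+
    also have "\<dots> = (\<Sum>d\<in>?D. card (exits d n))"
      by (intro sum.cong refl card_image inj_onI) (use exits_unique in blast)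
    finally show ?thesis .
  qed
  have "\<bar>int (sing_count (int n)) - int (\<Sum>d\<in>?D. m d) * int n\<bar> \<le> int (\<Sum>d\<in>?D. B d)" for n
  proof -
    have "int (sing_count (int n)) - int (\<Sum>d\<in>?D. m d) * int n
        = (\<Sum>d\<in>?D. int (card (exits d n)) - int (m d) * int n)"
      by (simp add: cnt sum_subtractf sum_distrib_right)
    also have "\<bar>\<dots>\<bar> \<le> (\<Sum>d\<in>?D. \<bar>int (card (exits d n)) - int (m d) * int n\<bar>)" by (rule sum_abs)
    also have "\<dots> \<le> (\<Sum>d\<in>?D. int (B d))" by (intro sum_mono mB)
    finally show ?thesis by simp
  qed
  then show ?thesis by blast
qed

lemma sing_count_linear:
  "\<exists>(m::nat) B. \<forall>n. m * n \<le> sing_count (int n) \<and> sing_count (int n) \<le> m * n + B"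
proof -
  obtain m B :: nat where mB: "\<bar>int (sing_count (int n)) - int m * int n\<bar> \<le> int B" for n
    using sing_count_almost_linear by metis
  have "m * n \<le> sing_count (int n)" for n
  proof (rule ccontr)
    assume "\<not> m * n \<le> sing_count (int n)"
    then have "int (sing_count (int n)) + 1 \<le> int m * int n"
      by (metis Suc_eq_plus1 Suc_leI not_le of_nat_1 of_nat_add of_nat_le_iff of_nat_mult)
    \<comment> \<open>The factor \<open>B + 1\<close> amplifies the deficit at \<open>n\<close>
      beyond the error bound \<open>B\<close>.\<close>
    then have "int (Suc B) * (int (sing_count (int n)) + 1) \<le> int (Suc B) * (int m * int n)"
      by (rule mult_left_mono) simp
    moreover have "int (sing_count (int (Suc B) * int n)) \<le> int (Suc B) * int (sing_count (int n))"
      using sing_count_mult[of "Suc B" "int n"] by (metis of_nat_le_iff of_nat_mult)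
    moreover have "int m * int (Suc B * n) - int B \<le> int (sing_count (int (Suc B * n)))"
      using mB[of "Suc B * n"] by linarith
    ultimately show False by (simp add: algebra_simps)
  qed
  moreover have "sing_count (int n) \<le> m * n + B" for n
    using mB[of n] by (metis abs_le_D1 diff_le_eq of_nat_add of_nat_le_iff of_nat_mult add.commute)
  ultimately show ?thesis by blast
qed

end

section \<open>Growth of the number of singular points\<close>

text \<open>The error is two-sided so that this also covers differences of two counts, whose error
  may be negative.\<close>

lemma grows_linearly_or_bounded:
  fixes u :: "int \<Rightarrow> nat" and m :: int and B :: nat
  assumes "0 \<le> m" "\<And>n. \<bar>int (u n) - m * \<bar>n\<bar>\<bar> \<le> int B"
  shows "grows_linearly u \<or> bdd_above (range u)"
proof (cases "m = 0")
  case True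
  then have "u n \<le> B" for n using assms(2)[of n] by simp
  then show ?thesis by (intro disjI2 bdd_aboveI2)
next
  case False
  have "\<bar>real (u n) - real_of_int m * \<bar>real_of_int n\<bar>\<bar> \<le> real B" for n
  proof -
    have "real_of_int \<bar>int (u n) - m * \<bar>n\<bar>\<bar> \<le> real_of_int (int B)"
      using assms(2)[of n] by (simp only: of_int_le_iff)
    then show ?thesis by simp
  qed
  moreover have "real_of_int m > 0" using False assms(1) by simp
  ultimately have "grows_linearly u"
    unfolding grows_linearly_def by (intro exI[of _ "real_of_int m"] conjI exI[of _ "real B"] allI)
  then show ?thesis ..
qed

lemma slope_le:
  fixes m m' B :: nat
  assumes "\<And>n. m * n \<le> m' * n + B"
  shows "m \<le> m'"
proof (rule ccontr)
  assume "\<not> m \<le> m'"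
  then have "(m' + 1) * (B + 1) \<le> m * (B + 1)" by (intro mult_right_mono) auto
  with assms[of "B + 1"] show False by simp
qed

text \<open>The representatives compose only up to finite sets, but \<open>regular\<close> and
  \<open>right_lim\<close> ignore these, so they form a partial action exactly.\<close>

lemma irregular_count_linear:
  fixes r :: "int \<Rightarrow> circle \<Rightarrow> circle"
  assumes r: "\<And>n. r n \<in> parcelwise_Ck k"
    and add: "\<And>p n. \<forall>\<^sub>F x in cofinite. r (p + n) x = r p (r n x)"
    and zero: "\<forall>\<^sub>F x in cofinite. r 0 x = x"
    and i: "i \<le> k"
  defines "c \<equiv> \<lambda>n. card {x. \<not> regular i (r n) x}"
  shows "\<exists>(m::nat) B. \<forall>n. m * nat \<bar>n\<bar> \<le> c n \<and> c n \<le> m * nat \<bar>n\<bar> + B"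
    and "c (- n) = c n"
proof -
  have inv: "\<forall>\<^sub>F x in cofinite. r (- n) (r n x) = x" for n
    using add[of "- n" n] zero by eventually_elim simp
  have inv': "\<forall>\<^sub>F x in cofinite. r n (r (- n) x) = x" for n
    using inv[of "- n"] by simp
  \<comment> \<open>Valid for \<open>n\<close> of either sign; applied to \<open>n\<close> and to
    \<open>- n\<close> it gives equality.\<close>
  have le: "c n \<le> c (- n)" for n
    unfolding c_def by (rule card_irregular_le[OF r r i inv inv'])
  show even: "c (- n) = c n" for n
    using le[of n] le[of "- n"] by (intro antisym) simp_all
  interpret partial_int_action "\<lambda>n. regular i (r n)" "\<lambda>n. right_lim (r n)"
  proof
    fix n p x
    show "regular i (r 0) x" "right_lim (r 0) x = x" using regular_id[OF zero] by auto
    show "finite {x. \<not> regular i (r n) x}" by (rule finite_irregular[OF r i])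
    assume n: "regular i (r n) x"
    show "regular i (r (- n)) (right_lim (r n) x)" by (rule regular_inverse[OF n inv])
    assume "regular i (r p) (right_lim (r n) x)"
    from regular_compose[OF r n this add]
    show "regular i (r (p + n)) x" "right_lim (r (p + n)) x = right_lim (r p) (right_lim (r n) x)"
      by auto
  qed
  have c: "c = sing_count" by (simp add: c_def sing_count_def fun_eq_iff)
  obtain m B where mB: "m * n \<le> c (int n)" "c (int n) \<le> m * n + B" for n
    using sing_count_linear unfolding c by blast
  have "c n = c (int (nat \<bar>n\<bar>))" for n
    using even[of n] by (cases "n \<ge> 0") auto
  with mB show "\<exists>(m::nat) B. \<forall>n. m * nat \<bar>n\<bar> \<le> c n \<and> c n \<le> m * nat \<bar>n\<bar> + B"
    by metis
qed

theorem corollary2p4: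
  fixes k :: nat and \<sigma> :: "(circle \<Rightarrow> circle) set"
  assumes "\<sigma> \<in> carrier (PC k)"
  shows "(\<exists>(m :: nat \<Rightarrow> int) (b :: nat \<Rightarrow> int \<Rightarrow> nat).
            0 \<le> m 0 \<and> (\<forall>i<k. m i \<le> m (Suc i)) \<and>
            (\<forall>i\<le>k. bdd_above (range (b i)) \<and> (\<forall>n. b i (- n) = b i n) \<and>
               (\<forall>n::int. int (k_le i (\<sigma> [^]\<^bsub>PC k\<^esub> n)) = m i * \<bar>n\<bar> + int (b i n)))) \<and>
         (\<forall>i\<le>k.
            (grows_linearly (\<lambda>n. k_le i (\<sigma> [^]\<^bsub>PC k\<^esub> n)) \<or>
             bdd_above (range (\<lambda>n::int. k_le i (\<sigma> [^]\<^bsub>PC k\<^esub> n)))) \<and>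
            (grows_linearly (\<lambda>n. k_num i (\<sigma> [^]\<^bsub>PC k\<^esub> n)) \<or>
             bdd_above (range (\<lambda>n::int. k_num i (\<sigma> [^]\<^bsub>PC k\<^esub> n)))))"
proof -
  interpret group "PC k" by (rule group_PC)
  obtain r :: "int \<Rightarrow> circle \<Rightarrow> circle" where r:
    "\<And>n. r n \<in> parcelwise_Ck k" "\<And>n. r n \<in> \<sigma> [^]\<^bsub>PC k\<^esub> n"
    "\<And>p n. \<forall>\<^sub>F x in cofinite. r (p + n) x = r p (r n x)"
    "\<forall>\<^sub>F x in cofinite. r 0 x = x"
    by (rule PC_power_representatives[OF assms]) (rule that)
  define c where "c i n = k_le i (\<sigma> [^]\<^bsub>PC k\<^esub> n)" for i and n :: int
  have k_num: "k_num i (\<sigma> [^]\<^bsub>PC k\<^esub> n) = card (K_rep (r n) i)" for i n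
    unfolding k_num_def using K_eq_K_rep[OF int_pow_closed[OF assms] r(2)] by simp
  have c: "c i n = card {x. \<not> regular i (r n) x}" if "i \<le> k" for i n
    using sum_card_K_rep[OF r(1) that] by (simp add: c_def k_le_def k_num)
  have c_Suc: "c (Suc i) n = c i n + k_num (Suc i) (\<sigma> [^]\<^bsub>PC k\<^esub> n)" for i n
    by (simp add: c_def k_le_def)
  \<comment> \<open>The condition on \<open>i\<close> sits inside the existential so that
    \<open>m\<close> and \<open>B\<close> can be chosen as total functions.\<close>
  have "\<exists>(m::nat) B. i \<le> k \<longrightarrow> (\<forall>n. m * nat \<bar>n\<bar> \<le> c i n \<and> c i n \<le> m * nat \<bar>n\<bar> + B)" for i
    using irregular_count_linear(1)[OF r(1,3,4), of i] by (cases "i \<le> k") (auto simp: c)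
  then obtain m B :: "nat \<Rightarrow> nat" where mB:
    "i \<le> k \<Longrightarrow> m i * nat \<bar>n\<bar> \<le> c i n" "i \<le> k \<Longrightarrow> c i n \<le> m i * nat \<bar>n\<bar> + B i" for i n
    by metis
  have even: "c i (- n) = c i n" if "i \<le> k" for i n
    using irregular_count_linear(2)[OF r(1,3,4) that] by (simp add: c that)
  have m_mono: "m i \<le> m (Suc i)" if "Suc i \<le> k" for i
  proof (rule slope_le)
    fix n
    have "m i * n \<le> c i (int n)" using mB(1)[of i "int n"] that by simp
    also have "\<dots> \<le> c (Suc i) (int n)" by (simp add: c_Suc)
    also have "\<dots> \<le> m (Suc i) * n + B (Suc i)" using mB(2)[of "Suc i" "int n"] that by simp
    finally show "m i * n \<le> m (Suc i) * n + B (Suc i)" .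
  qed
  \<comment> \<open>For \<open>i \<le> k\<close> the lower bound in \<open>mB\<close> keeps this
    natural subtraction from being truncated.\<close>
  define b where "b i n = c i n - m i * nat \<bar>n\<bar>" for i n
  have b: "c i n = m i * nat \<bar>n\<bar> + b i n" "b i n \<le> B i" if "i \<le> k" for i n
    using mB[OF that, of n] by (auto simp: b_def)
  then have cb: "int (c i n) = int (m i) * \<bar>n\<bar> + int (b i n)" if "i \<le> k" for i n
    using that by simp
  have growth: "\<bar>int (c i n) - int (m i) * \<bar>n\<bar>\<bar> \<le> int (B i)" if "i \<le> k" for i n
    using cb[OF that, of n] b(2)[OF that, of n] by simp
  have le: "grows_linearly (c i) \<or> bdd_above (range (c i))" if "i \<le> k" for i
    by (rule grows_linearly_or_bounded[OF _ growth[OF that]]) simp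
  have num: "grows_linearly (\<lambda>n. k_num i (\<sigma> [^]\<^bsub>PC k\<^esub> n)) \<or>
      bdd_above (range (\<lambda>n::int. k_num i (\<sigma> [^]\<^bsub>PC k\<^esub> n)))" if i: "i \<le> k" for i
  proof (cases i)
    case 0
    have "k_num 0 (\<sigma> [^]\<^bsub>PC k\<^esub> n) = c 0 n" for n :: int by (simp add: c_def k_le_def)
    then show ?thesis
      using grows_linearly_or_bounded[OF _ growth[OF i]] by (simp add: 0)
  next
    case (Suc j)
    show ?thesis
    \<comment> \<open>The number of points of K_i is the difference of two consecutive counts:
      slopes subtract, error bounds add.\<close>
    proof (rule grows_linearly_or_bounded[of "int (m i) - int (m j)" _ "B i + B j"])
      show "0 \<le> int (m i) - int (m j)" using m_mono i Suc by simp
      fix n :: int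
      have j: "j \<le> k" using i Suc by simp
      have "int (k_num i (\<sigma> [^]\<^bsub>PC k\<^esub> n)) = int (c i n) - int (c j n)"
        using c_Suc[of j n] by (simp add: Suc)
      then show "\<bar>int (k_num i (\<sigma> [^]\<^bsub>PC k\<^esub> n)) - (int (m i) - int (m j)) * \<bar>n\<bar>\<bar> \<le> int (B i + B j)"
        using growth[OF i, of n] growth[OF j, of n] by (simp add: left_diff_distrib)
    qed
  qed
  have "\<exists>(m :: nat \<Rightarrow> int) (b :: nat \<Rightarrow> int \<Rightarrow> nat). 0 \<le> m 0 \<and> (\<forall>i<k. m i \<le> m (Suc i)) \<and>
      (\<forall>i\<le>k. bdd_above (range (b i)) \<and> (\<forall>n. b i (- n) = b i n) \<and>
        (\<forall>n. int (c i n) = m i * \<bar>n\<bar> + int (b i n)))"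
  proof (intro exI conjI allI impI)
    fix i assume i: "i \<le> k"
    show "bdd_above (range (b i))" by (rule bdd_aboveI2) (rule b(2)[OF i])
    show "b i (- n) = b i n" for n by (simp add: b_def even[OF i])
    show "int (c i n) = int (m i) * \<bar>n\<bar> + int (b i n)" for n by (rule cb[OF i])
  qed (use m_mono in auto)
  from this[unfolded c_def] show ?thesis
    by (intro conjI allI impI le[unfolded c_def[abs_def]] num)
qed

end
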